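(* Let $\mathbb{T}$ be a time scale, let $a,b\in\mathbb{T}$ with $a<b$ and $\frac{a+b}{2}\in\mathbb{T}$, let $f:[a,b]\to\mathbb{R}$ be differentiable, and put $M=\sup_{a<x<b}|f^\Delta(x)|$. Suppose that $\alpha_1\in\left[a,\frac{a+b}{2}\right]\cap\mathbb{T}$ and $\alpha_2\in\left[\frac{a+b}{2},b\right]\cap\mathbb{T}$. Then we have the sharp inequality on time scales $$\left|\int_a^b f^\sigma(t)\,\Delta t-\left((\alpha_1-a)f(a)+(\alpha_2-\alpha_1)f\left(\tfrac{a+b}{2}\right)+(b-\alpha_2)f(b)\right)\right|\le M\left(h_2(a,\alpha_1)+h_2\left(\tfrac{a+b}{2},\alpha_1\right)+h_2\left(\tfrac{a+b}{2},\alpha_2\right)+h_2(b,\alpha_2)\right).$$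
   Context: A time scale $\mathbb{T}$ is an arbitrary nonempty closed subset of $\mathbb{R}$. An interval means the intersection of the real interval with $\mathbb{T}$. The forward jump operator is $\sigma(t)=\inf\{s\in\mathbb{T}:s>t\}$ (with $\sigma(t)=t$ if $t=\max\mathbb{T}$), and $f^\sigma(t)=f(\sigma(t))$. If $\mathbb{T}$ has a left-scattered maximum $m$ (i.e. $\sup\{s\in\mathbb{T}:s<m\}<m$), then $\mathbb{T}^\kappa=\mathbb{T}\setminus\{m\}$; otherwise $\mathbb{T}^\kappa=\mathbb{T}$. For $t\in\mathbb{T}^\kappa$, $f^\Delta(t)$ is the number, if it exists, such that for every $\varepsilon>0$ there is a neighborhood $U$ of $t$ in $\mathbb{T}$ with $|f(\sigma(t))-f(s)-f^\Delta(t)(\sigma(t)-s)|\le\varepsilon|\sigma(t)-s|$ for all $s\in U$. Differentiable means $\Delta$-differentiable, i.e. $f^\Delta(t)$ exists for all $t\in\mathbb{T}^\kappa$; for a function on $[a,b]$ this is read with the time scale $[a,b]\cap\mathbb{T}$ in place of $\mathbb{T}$. $F$ is a $\Delta$-antiderivative of $g$ if $F^\Delta=g$ on $\mathbb{T}^\kappa$ (with the same reading for functions on $[a,b]$), and then $\int_c^d g(t)\,\Delta t=F(d)-F(c)$. Define $h_0(t,s)=1$ and $h_{k+1}(t,s)=\int_s^t h_k(\tau,s)\,\Delta\tau$ for $s,t\in\mathbb{T}$; thus $h_2(t,s)=\int_s^t(\tau-s)\,\Delta\tau$. "Sharp" is used in the sense that the right-hand side of the inequality cannot be replaced by a smaller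 one.
   Formalization: The inequality with M the sup over a<x<b is stated only if a is right-dense (σ(a)=a) or α₁=a, since it fails otherwise (e.g. T={0,1,2}, α₁=α₂=1, f=1,0,0); in all cases it is stated, with sharpness, for M the sup over a≤x<b. *)

theory Defs
  imports "HOL-Analysis.Analysis"
begin

definition time_scale :: "real set \<Rightarrow> bool" where
  "time_scale T \<longleftrightarrow> T \<noteq> {} \<and> closed T"

definition forward_jump :: "real set \<Rightarrow> real \<Rightarrow> real" where
  "forward_jump T t = (if \<exists>s\<in>T. t < s then Inf {s \<in> T. t < s} else t)"

(* The first conjunct only keeps Sup away from the empty set: the point of a one-point time scale
   is not left-scattered. *)
definition left_scattered :: "real set \<Rightarrow> real \<Rightarrow> bool" where
  "left_scattered T t \<longleftrightarrow> (\<exists>s\<in>T. s < t) \<and> Sup {s \<in> T. s < t} < t"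

definition time_scale_kappa :: "real set \<Rightarrow> real set" where
  "time_scale_kappa T = T - {m \<in> T. (\<forall>s\<in>T. s \<le> m) \<and> left_scattered T m}"

definition has_delta_derivative :: "real set \<Rightarrow> (real \<Rightarrow> real) \<Rightarrow> real \<Rightarrow> real \<Rightarrow> bool" where
  "has_delta_derivative T f D t \<longleftrightarrow>
     (\<forall>e>0. \<exists>U. open U \<and> t \<in> U \<and>
        (\<forall>s\<in>U \<inter> T. \<bar>f (forward_jump T t) - f s - D * (forward_jump T t - s)\<bar>
                       \<le> e * \<bar>forward_jump T t - s\<bar>))"

definition delta_differentiable :: "real set \<Rightarrow> (real \<Rightarrow> real) \<Rightarrow> bool" where
  "delta_differentiable T f \<longleftrightarrow> (\<forall>t\<in>time_scale_kappa T. \<exists>D. has_delta_derivative T f D t)"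

(* Meaningful for t in time_scale_kappa T, where the derivative is unique if it exists. *)
definition delta_deriv :: "real set \<Rightarrow> (real \<Rightarrow> real) \<Rightarrow> real \<Rightarrow> real" where
  "delta_deriv T f t = (THE D. has_delta_derivative T f D t)"

definition delta_antiderivative :: "real set \<Rightarrow> (real \<Rightarrow> real) \<Rightarrow> (real \<Rightarrow> real) \<Rightarrow> bool" where
  "delta_antiderivative T g F \<longleftrightarrow> (\<forall>t\<in>time_scale_kappa T. has_delta_derivative T F (g t) t)"

definition delta_integral :: "real set \<Rightarrow> (real \<Rightarrow> real) \<Rightarrow> real \<Rightarrow> real \<Rightarrow> real" where
  "delta_integral T g c d = (THE I. \<exists>F. delta_antiderivative T g F \<and> I = F d - F c)"

primrec delta_h :: "real set \<Rightarrow> nat \<Rightarrow> real \<Rightarrow> real \<Rightarrow> real" where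
  "delta_h T 0 t s = 1"
| "delta_h T (Suc k) t s = delta_integral T (\<lambda>\<tau>. delta_h T k \<tau> s) s t"

(* Extended real, since the derivative of a differentiable function may be unbounded.
   The range X is a parameter because {a<..<b} misses the derivative at a right-scattered a, on
   which the integral over [a,b] depends; at a right-dense a, {a<..<b} and {a..<b} give the same
   supremum. *)
definition delta_deriv_sup :: "real set \<Rightarrow> (real \<Rightarrow> real) \<Rightarrow> real set \<Rightarrow> ereal" where
  "delta_deriv_sup T f X = (SUP x\<in>X \<inter> T. ereal \<bar>delta_deriv T f x\<bar>)"

(* The inequality E f <= M f * S holds on the class P, and S cannot be replaced by any smaller
   number. In the second part M f must be finite: otherwise, for negative C, any f with
   M f = \<infinity> would be a trivial witness. *)
definition sharp_inequality ::
    "('f \<Rightarrow> bool) \<Rightarrow> ('f \<Rightarrow> real) \<Rightarrow> ('f \<Rightarrow> ereal) \<Rightarrow> real \<Rightarrow> bool" where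
  "sharp_inequality P E M S \<longleftrightarrow>
     (\<forall>f. P f \<longrightarrow> ereal (E f) \<le> M f * ereal S) \<and>
     (\<forall>C<S. \<exists>f. P f \<and> M f < \<infinity> \<and> M f * ereal C < ereal (E f))"

end

theory Submission
  imports Defs
begin

text \<open>Put \<open>m = (a + b) / 2\<close> and let \<open>F\<close> be an antiderivative of \<open>f\<^sup>\<sigma>\<close>. By the product rule,
  \<open>\<Phi>\<^sub>\<alpha>(t) = (t - \<alpha>) f(t) - F(t)\<close> has derivative \<open>(t - \<alpha>) f\<^sup>\<Delta>(t)\<close>, and the error of the quadrature rule
  is, up to sign, the increment of \<open>\<Phi>\<close> with \<open>\<alpha> = \<alpha>\<^sub>1\<close> on \<open>[a, m]\<close> and \<open>\<alpha> = \<alpha>\<^sub>2\<close> on \<open>[m, b]\<close>. The mean value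
  inequality compares it on each of \<open>[a, \<alpha>\<^sub>1]\<close>, \<open>[\<alpha>\<^sub>1, m]\<close>, \<open>[m, \<alpha>\<^sub>2]\<close>, \<open>[\<alpha>\<^sub>2, b]\<close> with \<open>M\<close> times an antiderivative
  of \<open>\<bar>t - \<alpha>\<bar>\<close>, whose increments are the four values of \<open>h\<^sub>2\<close>; \<open>f\<^sup>\<Delta>\<close> itself is never integrated.

  For sharpness, take \<open>f\<^sup>\<Delta>\<close> to be a continuous approximation of the sign of the kernel \<open>t - \<alpha>\<close>. The kernel
  jumps at \<open>m\<close>, so the approximation is wrong only close to the left of \<open>m\<close>: on a short interval if
  \<open>m\<close> is left-dense, on no point at all if \<open>m\<close> is left-scattered.\<close>

subsection \<open>Delta derivatives\<close>

lemma forward_jump_ge: "t \<le> forward_jump T t"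
  unfolding forward_jump_def by (auto intro!: cInf_greatest)

lemma forward_jump_le: "s \<in> T \<Longrightarrow> t < s \<Longrightarrow> forward_jump T t \<le> s"
  unfolding forward_jump_def by (auto intro!: cInf_lower bdd_belowI[of _ t])

lemma forward_jump_in:
  assumes "closed T" "t \<in> T"
  shows "forward_jump T t \<in> T"
proof (cases "\<exists>s\<in>T. t < s")
  case True
  then have "Inf {s \<in> T. t < s} \<in> closure {s \<in> T. t < s}"
    by (intro closure_contains_Inf) (auto intro!: bdd_belowI[of _ t])
  moreover have "closure {s \<in> T. t < s} \<subseteq> T"
    using assms(1) by (intro closure_minimal) auto
  ultimately show ?thesis
    using True by (auto simp: forward_jump_def)
next
  case False
  then show ?thesis
    using assms by (simp add: forward_jump_def)
qed

lemma right_dense_approx: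
  assumes "forward_jump T t = t" "d \<in> T" "t < d" "e > 0"
  shows "\<exists>s\<in>T. t < s \<and> s \<le> d \<and> s < t + e"
proof -
  have "Inf {s \<in> T. t < s} < t + e"
    using assms by (auto simp: forward_jump_def split: if_splits)
  then obtain s where "s \<in> T" "t < s" "s < t + e"
    using assms cInf_lessD[of "{s \<in> T. t < s}" "t + e"] by blast
  then show ?thesis
    using assms by (intro bexI[of _ "min s d"]) (auto simp: min_def)
qed

lemma has_delta_derivativeE:
  assumes "has_delta_derivative T f D t" "e > 0"
  obtains d where "d > 0"
    "\<And>s. s \<in> T \<Longrightarrow> \<bar>s - t\<bar> < d \<Longrightarrow>
       \<bar>f (forward_jump T t) - f s - D * (forward_jump T t - s)\<bar> \<le> e * \<bar>forward_jump T t - s\<bar>"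
proof -
  obtain U where U: "open U" "t \<in> U" "\<forall>s\<in>U \<inter> T.
      \<bar>f (forward_jump T t) - f s - D * (forward_jump T t - s)\<bar> \<le> e * \<bar>forward_jump T t - s\<bar>"
    using assms(1)[unfolded has_delta_derivative_def, THEN spec, THEN mp, OF assms(2)] by blast
  obtain d where "d > 0" "ball t d \<subseteq> U"
    using openE[OF U(1,2)] by blast
  then show ?thesis
    using U(3) by (intro that[of d]) (auto simp: subset_iff dist_real_def abs_minus_commute)
qed

text \<open>The defining estimate is anchored at the forward jump, not at \<open>t\<close>. It is
  used twice, for \<open>s\<close> and for \<open>t\<close> itself; in the difference the value at
  the jump cancels.\<close>

lemma has_delta_derivative_imp_continuous:
  assumes "has_delta_derivative T f D t" "t \<in> T"
  shows "continuous (at t within T) f"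
  unfolding continuous_within_eps_delta
proof safe
  fix e :: real assume "e > 0"
  define j where "j = forward_jump T t"
  \<comment> \<open>For \<open>s\<close> within distance 1 of \<open>t\<close>, the distances of
    \<open>s\<close> and \<open>t\<close> from the jump add up to at most
    \<open>2 * (j - t) + 1\<close>, so both errors together cost at most
    \<open>e / 2\<close>.\<close>
  define \<epsilon> where "\<epsilon> = e / (2 * (2 * (j - t) + 1))"
  have j: "t \<le> j" unfolding j_def by (rule forward_jump_ge)
  have "\<epsilon> > 0" using j \<open>e > 0\<close> by (simp add: \<epsilon>_def)
  then obtain d where d: "d > 0"
      "\<And>s. s \<in> T \<Longrightarrow> \<bar>s - t\<bar> < d \<Longrightarrow> \<bar>f j - f s - D * (j - s)\<bar> \<le> \<epsilon> * \<bar>j - s\<bar>"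
    using has_delta_derivativeE[OF assms(1), folded j_def] by blast
  define d' where "d' = min d (min 1 (e / (2 * (\<bar>D\<bar> + 1))))"
  have "d' > 0" using d(1) \<open>e > 0\<close> by (simp add: d'_def)
  moreover have "dist (f s) (f t) < e" if s: "s \<in> T" "dist s t < d'" for s
  proof -
    have st: "\<bar>s - t\<bar> < d" "\<bar>s - t\<bar> < 1" "\<bar>s - t\<bar> < e / (2 * (\<bar>D\<bar> + 1))"
      using s(2) by (auto simp: d'_def dist_real_def)
    have 1: "\<bar>f j - f s - D * (j - s)\<bar> \<le> \<epsilon> * \<bar>j - s\<bar>"
      using d(2)[OF s(1) st(1)] .
    have 2: "\<bar>f j - f t - D * (j - t)\<bar> \<le> \<epsilon> * \<bar>j - t\<bar>"
      using d assms(2) by simp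
    have "\<epsilon> * \<bar>j - s\<bar> + \<epsilon> * \<bar>j - t\<bar> \<le> \<epsilon> * (2 * (j - t) + 1)"
      using st(2) j \<open>\<epsilon> > 0\<close> by (simp flip: distrib_left)
    also have "\<dots> = e / 2"
      using j by (simp add: \<epsilon>_def field_simps)
    finally have 3: "\<epsilon> * \<bar>j - s\<bar> + \<epsilon> * \<bar>j - t\<bar> \<le> e / 2" .
    have "\<bar>D * (s - t)\<bar> \<le> (\<bar>D\<bar> + 1) * \<bar>s - t\<bar>"
      by (simp add: abs_mult mult_right_mono)
    also have "\<dots> < (\<bar>D\<bar> + 1) * (e / (2 * (\<bar>D\<bar> + 1)))"
      using st(3) by (intro mult_strict_left_mono) auto
    also have "\<dots> = e / 2"
      by (simp add: field_simps add_nonneg_eq_0_iff)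
    finally have 4: "\<bar>D * (s - t)\<bar> < e / 2" .
    have "f s - f t = (f j - f t - D * (j - t)) - (f j - f s - D * (j - s)) + D * (s - t)"
      by (simp add: algebra_simps)
    then show ?thesis
      using 1 2 3 4 by (simp add: dist_real_def)
  qed
  ultimately show "\<exists>d>0. \<forall>s\<in>T. dist s t < d \<longrightarrow> dist (f s) (f t) < e" by blast
qed

lemma has_delta_derivative_right_dense_iff:
  assumes "forward_jump T t = t"
  shows "has_delta_derivative T f D t \<longleftrightarrow> (f has_field_derivative D) (at t within T)"
proof -
  have "(\<exists>U. open U \<and> t \<in> U \<and> (\<forall>s\<in>U \<inter> T. \<bar>f t - f s - D * (t - s)\<bar> \<le> e * \<bar>t - s\<bar>))
      \<longleftrightarrow> (\<exists>d>0. \<forall>s\<in>T. norm (s - t) < d \<longrightarrow> norm (f s - f t - D * (s - t)) \<le> e * norm (s - t))"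
    (is "?L \<longleftrightarrow> ?R") for e
  proof -
    have eq: "\<bar>f t - f s - D * (t - s)\<bar> = norm (f s - f t - D * (s - t))" for s
      by (simp add: algebra_simps)
    show ?thesis
    proof
      assume ?L
      then show ?R
        unfolding eq by (metis IntI abs_minus_commute dist_real_def open_dist real_norm_def)
    next
      assume ?R
      then obtain d where "d > 0"
        "\<forall>s\<in>T. norm (s - t) < d \<longrightarrow> norm (f s - f t - D * (s - t)) \<le> e * norm (s - t)" by blast
      then show ?L
        unfolding eq by (intro exI[of _ "ball t d"]) (auto simp: dist_real_def abs_minus_commute)
    qed
  qed
  then show ?thesis
    unfolding has_delta_derivative_def has_field_derivative_def has_derivative_within_alt assms
    by (simp add: bounded_linear_mult_right)
qed

text \<open>The estimate splits: \<open>s = t\<close> forces the difference quotient over the gap,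
  and the other \<open>s\<close> near \<open>t\<close> add exactly continuity at
  \<open>t\<close>.\<close>

lemma has_delta_derivative_right_scattered_iff:
  assumes "t < forward_jump T t" "t \<in> T"
  shows "has_delta_derivative T f D t \<longleftrightarrow>
    continuous (at t within T) f \<and> f (forward_jump T t) - f t = D * (forward_jump T t - t)"
    (is "_ \<longleftrightarrow> _ \<and> f ?j - f t = _")
proof safe
  assume D: "has_delta_derivative T f D t"
  then show "continuous (at t within T) f"
    using assms by (blast intro: has_delta_derivative_imp_continuous)
  have "\<bar>f ?j - f t - D * (?j - t)\<bar> \<le> 0 + e" if "e > 0" for e
  proof -
    have "e / (?j - t) > 0" using that assms by simp
    then have "\<bar>f ?j - f t - D * (?j - t)\<bar> \<le> e / (?j - t) * \<bar>?j - t\<bar>"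
      using D assms(2) unfolding has_delta_derivative_def by blast
    also have "\<dots> = e" using assms by simp
    finally show ?thesis by simp
  qed
  then have "\<bar>f ?j - f t - D * (?j - t)\<bar> \<le> 0" by (rule field_le_epsilon)
  then show "f ?j - f t = D * (?j - t)" by simp
next
  assume c: "continuous (at t within T) f" and eq: "f ?j - f t = D * (?j - t)"
  show "has_delta_derivative T f D t"
    unfolding has_delta_derivative_def
  proof safe
    fix e :: real assume "e > 0"
    define \<epsilon> where "\<epsilon> = e * (?j - t) / 2"
    have "\<epsilon> > 0" using \<open>e > 0\<close> assms by (simp add: \<epsilon>_def)
    have "continuous (at t within T) (\<lambda>s. f s - D * s)"
      using c by (intro continuous_intros)
    then obtain d where d: "d > 0"
        "\<And>s. s \<in> T \<Longrightarrow> \<bar>s - t\<bar> < d \<Longrightarrow> \<bar>f s - D * s - (f t - D * t)\<bar> < \<epsilon>"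
      using \<open>\<epsilon> > 0\<close> unfolding continuous_within_eps_delta dist_real_def by meson
    \<comment> \<open>Such \<open>s\<close> keep at least half the gap away from the jump, so the
      allowance \<open>e * \<bar>?j - s\<bar>\<close> is at least \<open>\<epsilon>\<close>.\<close>
    define d' where "d' = min d ((?j - t) / 2)"
    have "d' > 0" using d assms by (simp add: d'_def)
    moreover have "\<bar>f ?j - f s - D * (?j - s)\<bar> \<le> e * \<bar>?j - s\<bar>" if s: "s \<in> T" "\<bar>s - t\<bar> < d'" for s
    proof -
      have "\<bar>f s - D * s - (f t - D * t)\<bar> < \<epsilon>"
        using d(2)[of s] s by (simp add: d'_def)
      moreover have "f ?j - f s - D * (?j - s) = - (f s - D * s - (f t - D * t))"
        using eq by (simp add: algebra_simps)
      moreover have "\<epsilon> \<le> e * \<bar>?j - s\<bar>"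
      proof -
        have "(?j - t) / 2 \<le> \<bar>?j - s\<bar>"
        proof -
          have "\<bar>s - t\<bar> < (?j - t) / 2" using s by (simp add: d'_def)
          then have "s - t < (?j - t) / 2" by (rule le_less_trans[OF abs_ge_self])
          then have "(?j - t) / 2 \<le> ?j - s" by (simp add: field_simps)
          then show ?thesis by (rule order_trans[OF _ abs_ge_self])
        qed
        then show ?thesis
          using \<open>e > 0\<close> mult_left_mono[of "(?j - t) / 2" "\<bar>?j - s\<bar>" e] by (simp add: \<epsilon>_def)
      qed
      ultimately show ?thesis by simp
    qed
    ultimately show "\<exists>U. open U \<and> t \<in> U \<and>
        (\<forall>s\<in>U \<inter> T. \<bar>f ?j - f s - D * (?j - s)\<bar> \<le> e * \<bar>?j - s\<bar>)"
      by (intro exI[of _ "ball t d'"]) (auto simp: dist_real_def abs_minus_commute)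
  qed
qed

lemma has_delta_derivative_iff:
  assumes "t \<in> T"
  shows "has_delta_derivative T f D t \<longleftrightarrow>
    (if forward_jump T t = t then (f has_field_derivative D) (at t within T)
     else continuous (at t within T) f \<and> f (forward_jump T t) - f t = D * (forward_jump T t - t))"
proof (cases "forward_jump T t = t")
  case True
  then show ?thesis by (simp add: has_delta_derivative_right_dense_iff)
next
  case False
  then have "t < forward_jump T t" using forward_jump_ge[of t T] by linarith
  from has_delta_derivative_right_scattered_iff[OF this assms] show ?thesis
    using False by (simp only: if_False)
qed

lemma has_delta_derivative_add:
  assumes "t \<in> T" "has_delta_derivative T f D t" "has_delta_derivative T g E t"
  shows "has_delta_derivative T (\<lambda>x. f x + g x) (D + E) t"
proof (cases "forward_jump T t = t")
  case True
  with assms show ?thesis by (simp add: has_delta_derivative_iff DERIV_add)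
next
  case False
  with assms show ?thesis by (simp add: has_delta_derivative_iff continuous_add distrib_right)
qed

lemma has_delta_derivative_cmult:
  assumes "t \<in> T" "has_delta_derivative T f D t"
  shows "has_delta_derivative T (\<lambda>x. c * f x) (c * D) t"
proof (cases "forward_jump T t = t")
  case True
  with assms show ?thesis by (simp add: has_delta_derivative_iff DERIV_cmult)
next
  case False
  with assms show ?thesis
    by (simp add: has_delta_derivative_iff continuous_mult continuous_const flip: right_diff_distrib)
qed

lemma has_delta_derivative_diff:
  assumes "t \<in> T" "has_delta_derivative T f D t" "has_delta_derivative T g E t"
  shows "has_delta_derivative T (\<lambda>x. f x - g x) (D - E) t"
  using has_delta_derivative_add[OF assms(1,2) has_delta_derivative_cmult[OF assms(1,3), of "-1"]]
  by (simp add: diff_conv_add_uminus del: add_uminus_conv_diff)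

lemma has_delta_derivative_ident: "t \<in> T \<Longrightarrow> has_delta_derivative T (\<lambda>x. x) 1 t"
  by (cases "forward_jump T t = t") (simp_all add: has_delta_derivative_iff)

text \<open>Product rule with factor \<open>x - c\<close>, in the form that evaluates
  \<open>f\<close> at the forward jump, as the integrand of the theorem does.\<close>

lemma has_delta_derivative_mult_ident:
  assumes "t \<in> T" "has_delta_derivative T f D t"
  shows "has_delta_derivative T (\<lambda>x. (x - c) * f x) ((t - c) * D + f (forward_jump T t)) t"
proof (cases "forward_jump T t = t")
  case True
  then show ?thesis
    using assms by (auto simp: has_delta_derivative_right_dense_iff intro!: derivative_eq_intros)
next
  case False
  then have *: "continuous (at t within T) f"
      "f (forward_jump T t) = f t + D * (forward_jump T t - t)"
    using assms by (auto simp: has_delta_derivative_iff)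
  have "(\<lambda>x. (x - c) * f x) (forward_jump T t) - (\<lambda>x. (x - c) * f x) t
     = ((t - c) * D + f (forward_jump T t)) * (forward_jump T t - t)"
    unfolding *(2) by algebra
  then show ?thesis
    using * False assms(1)
    by (simp add: has_delta_derivative_iff continuous_mult continuous_diff)
qed

lemma time_scale_kappa_less: "t \<in> T \<Longrightarrow> d \<in> T \<Longrightarrow> t < d \<Longrightarrow> t \<in> time_scale_kappa T"
  by (force simp: time_scale_kappa_def)

lemma delta_differentiable_imp_continuous_on:
  assumes "delta_differentiable T f"
  shows "continuous_on T f"
  unfolding continuous_on_eq_continuous_within
proof
  fix t assume t: "t \<in> T"
  show "continuous (at t within T) f"
  proof (cases "t \<in> time_scale_kappa T")
    case True
    then show ?thesis
      using assms t has_delta_derivative_imp_continuous unfolding delta_differentiable_def by blast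
  next
    \<comment> \<open>A point outside \<open>time_scale_kappa T\<close> is a left-scattered maximum,
      hence isolated in \<open>T\<close>, and continuity is automatic.\<close>
    case False
    define r where "r = Sup {s \<in> T. s < t}"
    have max: "\<And>s. s \<in> T \<Longrightarrow> s \<le> t" and "r < t"
      using False t by (auto simp: time_scale_kappa_def left_scattered_def r_def)
    have le_r: "s \<le> r" if "s \<in> T" "s \<noteq> t" for s
      unfolding r_def using that max[of s] by (intro cSup_upper) (auto intro!: bdd_aboveI[of _ t])
    have "\<not> t islimpt T"
    proof
      assume "t islimpt T"
      moreover have "0 < t - r" using \<open>r < t\<close> by simp
      ultimately obtain s where s: "s \<in> T" "s \<noteq> t" "dist s t < t - r"
        unfolding islimpt_approachable by blast
      then show False using le_r[OF s(1,2)] by (simp add: dist_real_def)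
    qed
    then have "at t within T = bot" by (simp add: trivial_limit_within)
    then show ?thesis by (simp add: continuous_within)
  qed
qed

lemma delta_antiderivative_imp_continuous_on:
  "delta_antiderivative T g F \<Longrightarrow> continuous_on T F"
  by (rule delta_differentiable_imp_continuous_on)
    (auto simp: delta_differentiable_def delta_antiderivative_def)

subsection \<open>The mean value inequality and uniqueness of integrals\<close>

text \<open>One step to the right, for the mean value inequality: the jump at a right-scattered
  point, a nearby point at a right-dense one, where the slack \<open>D - L\<close> absorbs the
  error.\<close>

lemma delta_local_increase:
  assumes "closed T" "t \<in> T" "d \<in> T" "t < d" "has_delta_derivative T F D t" "L < D"
  shows "\<exists>s\<in>T. t < s \<and> s \<le> d \<and> F t + L * (s - t) \<le> F s"
proof (cases "forward_jump T t = t")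
  case False
  then have less: "t < forward_jump T t" using forward_jump_ge[of t T] by simp
  have "F (forward_jump T t) - F t = D * (forward_jump T t - t)"
    using has_delta_derivative_right_scattered_iff[OF less assms(2)] assms(5) by blast
  moreover have "L * (forward_jump T t - t) \<le> D * (forward_jump T t - t)"
    using less assms(6) by (intro mult_right_mono) auto
  ultimately have "F t + L * (forward_jump T t - t) \<le> F (forward_jump T t)" by linarith
  then show ?thesis
    using less forward_jump_in[OF assms(1,2)] forward_jump_le[OF assms(3,4)] by blast
next
  case True
  have "D - L > 0" using assms by simp
  then obtain e where e: "e > 0" "\<And>s. s \<in> T \<Longrightarrow> \<bar>s - t\<bar> < e \<Longrightarrow>
      \<bar>F t - F s - D * (t - s)\<bar> \<le> (D - L) * \<bar>t - s\<bar>"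
    using has_delta_derivativeE[OF assms(5), unfolded True] by blast
  obtain s where s: "s \<in> T" "t < s" "s \<le> d" "s < t + e"
    using right_dense_approx[OF True assms(3,4) e(1)] by blast
  have "\<bar>F t - F s - D * (t - s)\<bar> \<le> (D - L) * \<bar>t - s\<bar>"
    using e(2)[of s] s by simp
  then have "F t + L * (s - t) \<le> F s"
    using s by (auto simp: algebra_simps abs_if split: if_splits)
  then show ?thesis using s by blast
qed

text \<open>With two derivatives \<open>A < B\<close>, the zero function \<open>f - f\<close> would
  have the positive derivative \<open>B - A\<close> and increase. The point \<open>d\<close>
  excludes an isolated maximum, where every number is a derivative.\<close>

lemma delta_derivative_unique:
  assumes "closed T" "t \<in> T" "d \<in> T" "t < d"
    "has_delta_derivative T f D t" "has_delta_derivative T f E t"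
  shows "D = E"
proof -
  have *: "\<not> A < B" if "has_delta_derivative T f A t" "has_delta_derivative T f B t" for A B
  proof
    assume "A < B"
    have "has_delta_derivative T (\<lambda>x. f x - f x) (B - A) t"
      by (rule has_delta_derivative_diff[OF assms(2) that(2,1)])
    moreover have "(B - A) / 2 < B - A" using \<open>A < B\<close> by simp
    ultimately obtain s where "t < s" "f t - f t + (B - A) / 2 * (s - t) \<le> f s - f s"
      using delta_local_increase[OF assms(1-4), of "\<lambda>x. f x - f x"] by blast
    then show False using \<open>A < B\<close> by (auto simp: mult_le_0_iff)
  qed
  show ?thesis using *[OF assms(5,6)] *[OF assms(6,5)] by simp
qed

lemma delta_deriv_eq:
  assumes "closed T" "t \<in> T" "d \<in> T" "t < d" "has_delta_derivative T f D t"
  shows "delta_deriv T f t = D"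
  unfolding delta_deriv_def using assms delta_derivative_unique by blast

text \<open>The points of \<open>[c, d]\<close> where the linear lower bound holds form a compact
  set; if its maximum were below \<open>d\<close>, \<open>delta_local_increase\<close> would give a
  larger element.\<close>

lemma delta_mean_value_ge:
  assumes T: "closed T" and c: "c \<in> T" and d: "d \<in> T" and "c \<le> d" and F: "continuous_on T F"
    and D: "\<And>t. t \<in> T \<Longrightarrow> c \<le> t \<Longrightarrow> t < d \<Longrightarrow> \<exists>D\<ge>L. has_delta_derivative T F D t"
  shows "F c + L * (d - c) \<le> F d"
proof -
  have "F c + L * (d - c) \<le> F d + e" if "e > 0" for e
  proof -
    \<comment> \<open>\<open>delta_local_increase\<close> needs a slope strictly below
      \<open>L\<close>. The total loss is at most \<open>e\<close>; the \<open>+ 1\<close> covers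
      \<open>c = d\<close>.\<close>
    define l where "l = L - e / (d - c + 1)"
    have l: "l < L" using \<open>e > 0\<close> \<open>c \<le> d\<close> by (simp add: l_def)
    define A where "A = {t \<in> T \<inter> {c..d}. F c + l * (t - c) \<le> F t}"
    have "closed A"
      unfolding A_def using T
      by (intro continuous_on_closed_Collect_le continuous_intros continuous_on_subset[OF F]) auto
    then have "compact ({c..d} \<inter> A)" by (simp add: compact_Int_closed)
    moreover have "{c..d} \<inter> A = A" by (auto simp: A_def)
    ultimately have "compact A" by simp
    moreover have "c \<in> A" using c \<open>c \<le> d\<close> by (simp add: A_def)
    ultimately obtain t where t: "t \<in> A" "\<And>s. s \<in> A \<Longrightarrow> s \<le> t"
      using compact_attains_sup[of A] by blast
    have "t = d"
    proof (rule ccontr)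
      assume "t \<noteq> d"
      then have "t < d" "t \<in> T" "c \<le> t" using t(1) by (auto simp: A_def)
      then obtain D where "L \<le> D" "has_delta_derivative T F D t" using D by blast
      then obtain s where s: "s \<in> T" "t < s" "s \<le> d" "F t + l * (s - t) \<le> F s"
        using delta_local_increase[OF T \<open>t \<in> T\<close> d \<open>t < d\<close>, of F D l] l by auto
      then have "s \<in> A" using t(1) by (auto simp: A_def algebra_simps)
      then show False using t(2) s(2) by fastforce
    qed
    then have "F c + l * (d - c) \<le> F d" using t(1) by (simp add: A_def)
    moreover have "e / (d - c + 1) * (d - c) \<le> e"
      using \<open>e > 0\<close> \<open>c \<le> d\<close> by (simp add: field_simps)
    ultimately show ?thesis by (simp add: l_def left_diff_distrib)
  qed
  then show ?thesis by (rule field_le_epsilon)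
qed

text \<open>\<open>F - G\<close> and \<open>G - F\<close> both have derivative 0, so both are
  nondecreasing; exchanging the end points covers \<open>d < c\<close>.\<close>

lemma delta_antiderivative_unique:
  assumes T: "closed T" and "c \<in> T" "d \<in> T"
    and F: "delta_antiderivative T g F" and G: "delta_antiderivative T g G"
  shows "F d - F c = G d - G c"
proof -
  have le: "F x - G x \<le> F y - G y"
    if xy: "x \<in> T" "y \<in> T" "x \<le> y"
      and F: "delta_antiderivative T g F" and G: "delta_antiderivative T g G" for x y F G
  proof -
    have "(\<lambda>t. F t - G t) x + 0 * (y - x) \<le> (\<lambda>t. F t - G t) y"
    proof (rule delta_mean_value_ge[OF T xy])
      show "continuous_on T (\<lambda>t. F t - G t)"
        by (intro continuous_intros delta_antiderivative_imp_continuous_on[OF F]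
            delta_antiderivative_imp_continuous_on[OF G])
      fix t assume t: "t \<in> T" "x \<le> t" "t < y"
      then have "t \<in> time_scale_kappa T" using xy time_scale_kappa_less by blast
      then show "\<exists>D\<ge>0. has_delta_derivative T (\<lambda>t. F t - G t) D t"
        using has_delta_derivative_diff[OF t(1), of F "g t" G "g t"] F G
        unfolding delta_antiderivative_def by fastforce
    qed
    then show ?thesis by simp
  qed
  show ?thesis
    using le[OF assms(2,3) _ F G] le[OF assms(2,3) _ G F] le[OF assms(3,2) _ F G] le[OF assms(3,2) _ G F]
    by linarith
qed

lemma delta_integral_eq:
  assumes "closed T" "c \<in> T" "d \<in> T" "delta_antiderivative T g F"
  shows "delta_integral T g c d = F d - F c"
  unfolding delta_integral_def using assms delta_antiderivative_unique by (intro the_equality) blast+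

lemma delta_integral_cong:
  assumes "\<And>t. t \<in> T \<Longrightarrow> g t = h t"
  shows "delta_integral T g c d = delta_integral T h c d"
proof -
  have "delta_antiderivative T g F = delta_antiderivative T h F" for F
    using assms by (auto simp: delta_antiderivative_def time_scale_kappa_def)
  then show ?thesis by (simp add: delta_integral_def)
qed

subsection \<open>Existence of antiderivatives\<close>

lemma continuous_on_closed_bounded_interval:
  fixes f :: "real \<Rightarrow> real"
  assumes "closed T" "continuous_on T f"
  obtains B where "\<And>y. y \<in> T \<Longrightarrow> u \<le> y \<Longrightarrow> y \<le> v \<Longrightarrow> \<bar>f y\<bar> \<le> B"
proof -
  have "compact (f ` (T \<inter> {u..v}))"
    using assms(1) by (intro compact_continuous_image continuous_on_subset[OF assms(2)])
      (auto intro: closed_Int_compact)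
  then have "bounded (f ` (T \<inter> {u..v}))" by (rule compact_imp_bounded)
  then obtain B where "\<forall>z\<in>f ` (T \<inter> {u..v}). norm z \<le> B"
    unfolding bounded_iff by blast
  then show ?thesis by (intro that[of B]) auto
qed

text \<open>\<open>\<phi>\<close> may jump, so the composite need not be continuous. It is
  measurable because monotone functions are Borel, and bounded because \<open>\<phi>\<close> takes
  its values in a compact part of \<open>T\<close>.\<close>

lemma integrable_on_continuous_mono_compose:
  fixes \<phi> f :: "real \<Rightarrow> real"
  assumes \<phi>: "mono_on {u..v} \<phi>" "\<phi> ` {u..v} \<subseteq> T" and T: "closed T" and f: "continuous_on T f"
  shows "(\<lambda>x. f (\<phi> x)) integrable_on {u..v}"
proof (cases "u \<le> v")
  case True
  obtain B where B: "\<And>y. y \<in> T \<Longrightarrow> \<phi> u \<le> y \<Longrightarrow> y \<le> \<phi> v \<Longrightarrow> \<bar>f y\<bar> \<le> B"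
    using continuous_on_closed_bounded_interval[OF T f] by blast
  have [measurable]: "\<phi> \<in> borel_measurable (restrict_space borel {u..v})"
    using \<phi>(1) by (rule borel_measurable_mono_on_fnc)
  have [measurable]: "(\<lambda>y. indicator T y *\<^sub>R f y) \<in> borel_measurable borel"
    using T f by (intro borel_measurable_continuous_on_indicator) auto
  have "(\<lambda>x. indicator T (\<phi> x) *\<^sub>R f (\<phi> x)) \<in> borel_measurable (restrict_space borel {u..v})"
    by (rule measurable_compose[of \<phi> _ borel "\<lambda>y. indicator T y *\<^sub>R f y"]) measurable
  moreover have "indicator T (\<phi> x) *\<^sub>R f (\<phi> x) = f (\<phi> x)" if "x \<in> {u..v}" for x
    using subsetD[OF \<phi>(2) imageI[OF that]] by simp
  ultimately have "(\<lambda>x. f (\<phi> x)) \<in> borel_measurable (restrict_space borel {u..v})"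
    by (subst measurable_cong[of _ _ "\<lambda>x. indicator T (\<phi> x) *\<^sub>R f (\<phi> x)"]) (auto simp: space_restrict_space)
  then have "(\<lambda>x. indicator {u..v} x *\<^sub>R f (\<phi> x)) \<in> borel_measurable borel"
    by (subst (asm) borel_measurable_restrict_space_iff) auto
  then have "(\<lambda>x. indicator {u..v} x *\<^sub>R f (\<phi> x)) \<in> borel_measurable lebesgue"
    by (intro measurable_completion) simp
  then have "(\<lambda>x. f (\<phi> x)) \<in> borel_measurable (lebesgue_on {u..v})"
    by (subst borel_measurable_restrict_space_iff) auto
  then show ?thesis
  proof (rule measurable_bounded_by_integrable_imp_integrable_real)
    show "\<bar>f (\<phi> x)\<bar> \<le> B" if "x \<in> {u..v}" for x
      using that True subsetD[OF \<phi>(2) imageI[OF that]] mono_onD[OF \<phi>(1), of u x] mono_onD[OF \<phi>(1), of x v]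
      by (intro B) simp_all
  qed auto
qed (simp add: integrable_on_empty)

text \<open>Used with \<open>\<psi>\<close> the identity and the forward jump. The antiderivative is the ordinary integral of the
  function with value \<open>f (\<psi> t)\<close> on the whole gap \<open>[t, \<sigma>(t))\<close>.\<close>

lemma delta_antiderivative_exists:
  assumes T: "closed T" and f: "continuous_on T f"
    and \<psi>: "\<And>t. t \<in> T \<Longrightarrow> \<psi> t \<in> T" "\<And>t. t \<in> T \<Longrightarrow> t \<le> \<psi> t" "\<And>t. t \<in> T \<Longrightarrow> \<psi> t \<le> forward_jump T t"
  shows "\<exists>F. delta_antiderivative T (\<lambda>t. f (\<psi> t)) F"
proof (cases "T = {}")
  case True
  then show ?thesis by (simp add: delta_antiderivative_def time_scale_kappa_def)
next
  case False
  then obtain c where c: "c \<in> T" by blast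
  \<comment> \<open>\<open>l x\<close> is the last point of \<open>T\<close> up to \<open>x\<close>,
    so \<open>h\<close> is constant on each gap. If \<open>T\<close> has no such point, the supremum
    is over the empty set; hence the \<open>u\<close> in the facts below.\<close>
  define l where "l x = Sup (T \<inter> {..x})" for x
  define \<phi> where "\<phi> x = \<psi> (l x)" for x
  define h where "h x = f (\<phi> x)" for x
  have l_ge: "s \<le> l x" if "s \<in> T" "s \<le> x" for s x
    unfolding l_def using that by (intro cSup_upper) auto
  have l: "l x \<in> T" "l x \<le> x" if "u \<in> T" "u \<le> x" for u x
  proof -
    have "closed (T \<inter> {..x})" using T by auto
    then have "l x \<in> T \<inter> {..x}"
      unfolding l_def using that by (intro closed_contains_Sup) auto
    then show "l x \<in> T" "l x \<le> x" by auto
  qed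
  have \<phi>_ge: "\<phi> x \<in> T" "u \<le> \<phi> x" if "u \<in> T" "u \<le> x" for u x
    using \<psi> l[OF that] l_ge[OF that] unfolding \<phi>_def by (auto intro: order_trans)
  have \<phi>_le: "\<phi> x \<le> v" if "u \<in> T" "u \<le> x" "v \<in> T" "x < v" for u v x
  proof -
    have "\<phi> x \<le> forward_jump T (l x)" unfolding \<phi>_def using \<psi> l that by blast
    also have "\<dots> \<le> v" using l(2)[OF that(1,2)] that by (intro forward_jump_le) auto
    finally show ?thesis .
  qed
  have mono: "mono_on {u..v} \<phi>" if "u \<in> T" for u v
  proof (rule mono_onI)
    fix x y assume xy: "x \<in> {u..v}" "y \<in> {u..v}" "x \<le> y"
    then have ly: "l y \<in> T" "l x \<le> l y"
      using l[OF that, of x] l[OF that, of y] l_ge[of "l x" y] by auto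
    show "\<phi> x \<le> \<phi> y"
    proof (cases "l x = l y")
      case False
      \<comment> \<open>Since \<open>x\<close> lies before \<open>l y\<close>, and
        \<open>\<phi> x\<close> never passes a later point of \<open>T\<close>,
        \<open>\<phi> x\<close> is at most \<open>l y\<close>.\<close>
      then have "x < l y"
        using ly l_ge[of "l y" x] by fastforce
      then have "\<phi> x \<le> l y" using \<phi>_le[OF that _ ly(1)] xy by simp
      also have "\<dots> \<le> \<phi> y" unfolding \<phi>_def using \<psi> ly by blast
      finally show ?thesis .
    qed (simp add: \<phi>_def)
  qed
  have int: "h integrable_on {u..v}" if "u \<in> T" for u v
    unfolding h_def using mono[OF that] \<phi>_ge(1)[OF that] T f
    by (intro integrable_on_continuous_mono_compose[of _ _ _ T]) auto
  \<comment> \<open>A signed integral with base point \<open>c\<close>: an integral over an empty or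
    degenerate interval is 0, so at most one term counts.\<close>
  define F where "F t = integral {c..t} h - integral {t..c} h" for t
  have F_diff: "F v - F u = integral {u..v} h" if uv: "u \<in> T" "v \<in> T" "u \<le> v" for u v
  proof -
    have z: "integral {y..x} h = 0" if "x \<le> y" for x y
      using that by (cases "x = y") auto
    consider "c \<le> u" | "u \<le> c" "c \<le> v" | "v \<le> c" by linarith
    then show ?thesis
    proof cases
      case 1
      then show ?thesis
        using Henstock_Kurzweil_Integration.integral_combine[OF 1 uv(3) int[OF c]] uv by (simp add: F_def z)
    next
      case 2
      then show ?thesis
        using Henstock_Kurzweil_Integration.integral_combine[OF 2 int[OF uv(1)]] uv by (simp add: F_def z)
    next
      case 3
      then show ?thesis
        using Henstock_Kurzweil_Integration.integral_combine[OF uv(3) 3 int[OF uv(1)]] uv by (simp add: F_def z)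
    qed
  qed
  \<comment> \<open>The bound is not asked at \<open>x = v\<close>, where \<open>\<phi> v\<close>
    may already have jumped past \<open>v\<close>; a single point does not affect the
    integral.\<close>
  have F_bound: "\<bar>F v - F u - D * (v - u)\<bar> \<le> B * (v - u)"
    if uv: "u \<in> T" "v \<in> T" "u \<le> v" and "0 \<le> B" and B: "\<And>x. u \<le> x \<Longrightarrow> x < v \<Longrightarrow> \<bar>h x - D\<bar> \<le> B"
    for u v D B
  proof -
    have "(h has_integral (F v - F u)) {u..v}"
      unfolding F_diff[OF uv] using int[OF uv(1)] by (rule integrable_integral)
    then have "((\<lambda>x. h x - D) has_integral (F v - F u - D * (v - u))) {u..v}"
      using has_integral_diff[OF _ has_integral_const_real[of D u v]] uv(3) by (simp add: mult.commute)
    then have "((\<lambda>x. h x - D) has_integral (F v - F u - D * (v - u))) (cbox u v)" by simp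
    from has_integral_bound_spike_finite[OF \<open>0 \<le> B\<close> _ this, of "{v}"] show ?thesis
      using B uv(3) by simp
  qed
  have "has_delta_derivative T F (f (\<psi> t)) t" if t: "t \<in> T" for t
  proof (cases "forward_jump T t = t")
    case True
    then have "\<psi> t = t" using \<psi>[OF t] by simp
    show ?thesis
      unfolding has_delta_derivative_def True \<open>\<psi> t = t\<close>
    proof safe
      fix e :: real assume "e > 0"
      then obtain d where d: "d > 0" "\<And>y. y \<in> T \<Longrightarrow> \<bar>y - t\<bar> < d \<Longrightarrow> \<bar>f y - f t\<bar> < e"
        using f[unfolded continuous_on_iff, rule_format, OF t \<open>e > 0\<close>] unfolding dist_real_def by blast
      have "\<bar>F t - F s - f t * (t - s)\<bar> \<le> e * \<bar>t - s\<bar>" if s: "s \<in> T" "\<bar>s - t\<bar> < d" for s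
      proof (cases "s \<le> t")
        case True
        have "\<bar>F t - F s - f t * (t - s)\<bar> \<le> e * (t - s)"
        proof (rule F_bound[OF s(1) t True])
          fix x assume "s \<le> x" "x < t"
          \<comment> \<open>\<open>\<phi> x\<close> stays between \<open>s\<close> and
            \<open>t\<close>, where \<open>f\<close> is within \<open>e\<close> of
            \<open>f t\<close>.\<close>
          then have "s \<le> \<phi> x" "\<phi> x \<le> t"
            using \<phi>_ge(2)[OF s(1)] \<phi>_le[OF s(1) _ t] by blast+
          then have "\<bar>\<phi> x - t\<bar> < d" using s(2) by linarith
          with d(2)[OF \<phi>_ge(1)[OF s(1) \<open>s \<le> x\<close>]] show "\<bar>h x - f t\<bar> \<le> e"
            unfolding h_def by (simp add: less_imp_le)
        qed (use \<open>e > 0\<close> in simp)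
        then show ?thesis using True by simp
      next
        case False
        then have "t \<le> s" by simp
        have "\<bar>F s - F t - f t * (s - t)\<bar> \<le> e * (s - t)"
        proof (rule F_bound[OF t s(1) \<open>t \<le> s\<close>])
          fix x assume "t \<le> x" "x < s"
          then have "t \<le> \<phi> x" "\<phi> x \<le> s"
            using \<phi>_ge(2)[OF t] \<phi>_le[OF t _ s(1)] by blast+
          then have "\<bar>\<phi> x - t\<bar> < d" using s(2) by linarith
          with d(2)[OF \<phi>_ge(1)[OF t \<open>t \<le> x\<close>]] show "\<bar>h x - f t\<bar> \<le> e"
            unfolding h_def by (simp add: less_imp_le)
        qed (use \<open>e > 0\<close> in simp)
        moreover have "F t - F s - f t * (t - s) = - (F s - F t - f t * (s - t))"
          by (simp add: algebra_simps)
        ultimately show ?thesis using \<open>t \<le> s\<close> by (simp only: abs_minus_cancel) simp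
      qed
      then show "\<exists>U. open U \<and> t \<in> U \<and> (\<forall>s\<in>U \<inter> T. \<bar>F t - F s - f t * (t - s)\<bar> \<le> e * \<bar>t - s\<bar>)"
        using d(1) by (intro exI[of _ "ball t d"]) (auto simp: dist_real_def abs_minus_commute)
    qed
  next
    case False
    then have less: "t < forward_jump T t" using forward_jump_ge[of t T] by simp
    have j: "forward_jump T t \<in> T" by (rule forward_jump_in[OF T t])
    \<comment> \<open>\<open>h\<close> is constant on the gap, so \<open>F_bound\<close> applies
      with bound 0 and gives the exact increment.\<close>
    have "\<bar>F (forward_jump T t) - F t - f (\<psi> t) * (forward_jump T t - t)\<bar> \<le> 0 * (forward_jump T t - t)"
    proof (rule F_bound[OF t j])
      fix x assume x: "t \<le> x" "x < forward_jump T t"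
      then have "l x = t"
        using l[OF t x(1)] l_ge[OF t x(1)] forward_jump_le[of "l x" T t] by fastforce
      then show "\<bar>h x - f (\<psi> t)\<bar> \<le> 0" by (simp add: h_def \<phi>_def)
    qed (use less in auto)
    moreover have "continuous (at t within T) F"
      unfolding continuous_within_eps_delta
    proof safe
      fix e :: real assume "e > 0"
      obtain B where B: "\<And>y. y \<in> T \<Longrightarrow> t - 1 \<le> y \<Longrightarrow> y \<le> t \<Longrightarrow> \<bar>f y\<bar> \<le> B"
        using continuous_on_closed_bounded_interval[OF T f] by blast
      then have "0 \<le> B" using t B[of t] by fastforce
      \<comment> \<open>The entries keep \<open>s\<close> where \<open>B\<close> bounds
        \<open>f\<close>, keep \<open>s\<close> from lying to the right of \<open>t\<close>, and
        make the increment of \<open>F\<close> less than \<open>e\<close>.\<close>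
      define d where "d = Min {1, forward_jump T t - t, e / (B + 1)}"
      have "d > 0" using less \<open>e > 0\<close> \<open>0 \<le> B\<close> by (simp add: d_def)
      moreover have "dist (F s) (F t) < e" if s: "s \<in> T" "dist s t < d" for s
      proof -
        have sd: "\<bar>s - t\<bar> < 1" "\<bar>s - t\<bar> < forward_jump T t - t" "\<bar>s - t\<bar> < e / (B + 1)"
          using s(2) by (auto simp: d_def dist_real_def)
        have st: "s \<le> t"
          using forward_jump_le[OF s(1), of t] sd(2) by fastforce
        have "\<bar>F t - F s - 0 * (t - s)\<bar> \<le> B * (t - s)"
        proof (rule F_bound[OF s(1) t st \<open>0 \<le> B\<close>])
          fix x assume x: "s \<le> x" "x < t"
          then show "\<bar>h x - 0\<bar> \<le> B"
            unfolding h_def using B[of "\<phi> x"] \<phi>_ge[OF s(1) x(1)] \<phi>_le[OF s(1) x(1) t x(2)] sd(1) by auto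
        qed
        also have "\<dots> \<le> (B + 1) * \<bar>s - t\<bar>"
          using \<open>0 \<le> B\<close> st by (simp add: mult_right_mono)
        also have "\<dots> < (B + 1) * (e / (B + 1))"
          using sd(3) \<open>0 \<le> B\<close> by (intro mult_strict_left_mono) auto
        also have "\<dots> = e" using \<open>0 \<le> B\<close> by simp
        finally show ?thesis by (simp add: dist_real_def abs_minus_commute)
      qed
      ultimately show "\<exists>d>0. \<forall>s\<in>T. dist s t < d \<longrightarrow> dist (F s) (F t) < e" by blast
    qed
    ultimately show ?thesis
      using has_delta_derivative_right_scattered_iff[OF less t] by simp
  qed
  then show ?thesis
    unfolding delta_antiderivative_def time_scale_kappa_def by blast
qed

subsection \<open>Restriction to an interval and the integral \<open>h\<^sub>2\<close>\<close>

lemma forward_jump_interval: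
  assumes "b \<in> T" "a \<le> t" "t < b"
  shows "forward_jump ({a..b} \<inter> T) t = forward_jump T t"
proof -
  have "Inf {s \<in> {a..b} \<inter> T. t < s} = Inf {s \<in> T. t < s}"
  proof (rule antisym)
    show "Inf {s \<in> {a..b} \<inter> T. t < s} \<le> Inf {s \<in> T. t < s}"
    proof (rule cInf_greatest)
      fix s assume "s \<in> {s \<in> T. t < s}"
      then show "Inf {s \<in> {a..b} \<inter> T. t < s} \<le> s"
        using assms by (intro cInf_lower2[of "min s b"]) (auto simp: min_def intro!: bdd_belowI[of _ t])
    qed (use assms in auto)
    show "Inf {s \<in> T. t < s} \<le> Inf {s \<in> {a..b} \<inter> T. t < s}"
      using assms by (intro cInf_superset_mono) (auto intro!: bdd_belowI[of _ t] exI[of _ b])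
  qed
  then show ?thesis
    using assms by (auto simp: forward_jump_def)
qed

text \<open>The values of \<open>h\<^sub>2\<close> in the theorem are taken on \<open>T\<close>, the
  integral on \<open>{a..b} \<inter> T\<close>. At \<open>b\<close> the two forward jumps may
  differ, hence \<open>t < b\<close>.\<close>

lemma has_delta_derivative_interval:
  assumes "b \<in> T" "a \<le> t" "t < b" "has_delta_derivative T F D t"
  shows "has_delta_derivative ({a..b} \<inter> T) F D t"
  using assms(4) unfolding has_delta_derivative_def forward_jump_interval[OF assms(1-3)]
  by (meson IntD1 IntD2 IntI)

lemma delta_h_1:
  assumes "closed T" "s \<in> T" "t \<in> T"
  shows "delta_h T 1 t s = t - s"
proof -
  have "delta_antiderivative T (\<lambda>_. 1) (\<lambda>x. x)"
    by (simp add: delta_antiderivative_def time_scale_kappa_def has_delta_derivative_ident)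
  then show ?thesis
    using delta_integral_eq[OF assms] by simp
qed

text \<open>The integral of \<open>x - s\<close> from \<open>s\<close> to \<open>t\<close>,
  evaluated with an antiderivative \<open>P\<close> of the identity; one \<open>P\<close> serves all
  four values in the theorem.\<close>

definition h2 :: "(real \<Rightarrow> real) \<Rightarrow> real \<Rightarrow> real \<Rightarrow> real" where
  "h2 P t s = P t - P s - s * (t - s)"

lemma delta_h_2:
  assumes T: "closed T" "s \<in> T" "t \<in> T" and P: "delta_antiderivative T (\<lambda>x. x) P"
  shows "delta_h T 2 t s = h2 P t s"
proof -
  have "delta_antiderivative T (\<lambda>x. x - s) (\<lambda>x. P x - s * x)"
    unfolding delta_antiderivative_def
  proof
    fix x assume x: "x \<in> time_scale_kappa T"
    then have "x \<in> T" by (simp add: time_scale_kappa_def)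
    then show "has_delta_derivative T (\<lambda>x. P x - s * x) (x - s) x"
      using has_delta_derivative_diff[OF _ _ has_delta_derivative_cmult[OF _ has_delta_derivative_ident],
          of x T P x s] P x unfolding delta_antiderivative_def by simp
  qed
  moreover have "delta_h T 2 t s = delta_integral T (\<lambda>x. x - s) s t"
    unfolding numeral_2_eq_2 delta_h.simps(2)[of T "Suc 0"]
    by (rule delta_integral_cong) (use delta_h_1[OF T(1,2)] in simp)
  ultimately show ?thesis
    using delta_integral_eq[OF T] by (simp add: h2_def right_diff_distrib)
qed

subsection \<open>Weighted mean value inequalities\<close>

text \<open>\<open>G - F\<close> and \<open>G + F\<close> both have nonnegative derivatives on
  \<open>[c, d)\<close>.\<close>

lemma delta_mean_value_abs:
  assumes "closed T" "c \<in> T" "d \<in> T" "c \<le> d" "continuous_on T F" "continuous_on T G"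
    and F: "\<And>t. t \<in> T \<Longrightarrow> c \<le> t \<Longrightarrow> t < d \<Longrightarrow> has_delta_derivative T F (F' t) t"
    and G: "\<And>t. t \<in> T \<Longrightarrow> c \<le> t \<Longrightarrow> t < d \<Longrightarrow> has_delta_derivative T G (G' t) t"
    and le: "\<And>t. t \<in> T \<Longrightarrow> c \<le> t \<Longrightarrow> t < d \<Longrightarrow> \<bar>F' t\<bar> \<le> G' t"
  shows "\<bar>F d - F c\<bar> \<le> G d - G c"
proof -
  have "(\<lambda>x. G x - F x) c + 0 * (d - c) \<le> (\<lambda>x. G x - F x) d"
  proof (rule delta_mean_value_ge[OF assms(1-4)])
    show "\<exists>D\<ge>0. has_delta_derivative T (\<lambda>x. G x - F x) D t" if "t \<in> T" "c \<le> t" "t < d" for t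
      using has_delta_derivative_diff[OF that(1) G[OF that] F[OF that]] le[OF that]
      by (intro exI[of _ "G' t - F' t"]) auto
  qed (intro continuous_on_diff assms)
  moreover have "(\<lambda>x. G x + F x) c + 0 * (d - c) \<le> (\<lambda>x. G x + F x) d"
  proof (rule delta_mean_value_ge[OF assms(1-4)])
    show "\<exists>D\<ge>0. has_delta_derivative T (\<lambda>x. G x + F x) D t" if "t \<in> T" "c \<le> t" "t < d" for t
      using has_delta_derivative_add[OF that(1) G[OF that] F[OF that]] le[OF that]
      by (intro exI[of _ "G' t + F' t"]) auto
  qed (intro continuous_on_add assms)
  ultimately show ?thesis by (simp add: abs_le_iff)
qed

text \<open>Compares \<open>F\<close> with \<open>M\<close> times \<open>G\<close>, where
  \<open>M\<close> may be infinite. Where the weight \<open>k\<close> vanishes nothing is asked of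
  \<open>g\<close>; this matters at \<open>a\<close> when
  \<open>\<alpha>\<^sub>1 = a\<close>.\<close>

lemma delta_weighted_mean_value:
  fixes M :: ereal
  assumes T: "closed T" "c \<in> T" "d \<in> T" "c \<le> d" and cont: "continuous_on T F" "continuous_on T G"
    and "0 \<le> M"
    and F: "\<And>t. t \<in> T \<Longrightarrow> c \<le> t \<Longrightarrow> t < d \<Longrightarrow> has_delta_derivative T F (k t * g t) t"
    and G: "\<And>t. t \<in> T \<Longrightarrow> c \<le> t \<Longrightarrow> t < d \<Longrightarrow> has_delta_derivative T G \<bar>k t\<bar> t"
    and g: "\<And>t. t \<in> T \<Longrightarrow> c \<le> t \<Longrightarrow> t < d \<Longrightarrow> k t \<noteq> 0 \<Longrightarrow> ereal \<bar>g t\<bar> \<le> M"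
  shows "G c \<le> G d" and "ereal \<bar>F d - F c\<bar> \<le> M * ereal (G d - G c)"
proof -
  have mono: "G x \<le> G y" if "x \<in> T" "y \<in> T" "c \<le> x" "x \<le> y" "y \<le> d" for x y
  proof -
    have "G x + 0 * (y - x) \<le> G y"
    proof (rule delta_mean_value_ge[OF T(1) that(1,2,4) cont(2)])
      show "\<exists>D\<ge>0. has_delta_derivative T G D t" if t: "t \<in> T" "x \<le> t" "t < y" for t
        using G[OF t(1)] t that \<open>c \<le> x\<close> \<open>y \<le> d\<close> by (intro exI[of _ "\<bar>k t\<bar>"]) simp
    qed
    then show ?thesis by simp
  qed
  then show "G c \<le> G d" using T by blast
  show "ereal \<bar>F d - F c\<bar> \<le> M * ereal (G d - G c)"
  proof (cases M)
    case (real r)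
    have "\<bar>F d - F c\<bar> \<le> r * G d - r * G c"
    proof (rule delta_mean_value_abs[OF T cont(1) _ F])
      show "continuous_on T (\<lambda>x. r * G x)" by (intro continuous_on_mult_left cont)
      fix t assume t: "t \<in> T" "c \<le> t" "t < d"
      show "has_delta_derivative T (\<lambda>x. r * G x) (r * \<bar>k t\<bar>) t"
        by (rule has_delta_derivative_cmult[OF t(1) G[OF t]])
      show "\<bar>k t * g t\<bar> \<le> r * \<bar>k t\<bar>"
        using g[OF t] real by (cases "k t = 0") (auto simp: abs_mult mult.commute)
    qed
    then show ?thesis by (simp add: real right_diff_distrib)
  next
    case PInf
    \<comment> \<open>Since \<open>\<infinity> * 0 = 0\<close>, the function \<open>F\<close> has to be constant if \<open>G\<close> is.\<close>
    show ?thesis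
    proof (cases "G c < G d")
      case True
      then show ?thesis by (simp add: PInf)
    next
      case False
      \<comment> \<open>A nonzero weight at one point would make \<open>G\<close> increase to the
        right of it, and then \<open>G c < G d\<close> by monotonicity.\<close>
      have "k t = 0" if t: "t \<in> T" "c \<le> t" "t < d" for t
      proof (rule ccontr)
        assume "k t \<noteq> 0"
        then have "\<bar>k t\<bar> / 2 < \<bar>k t\<bar>" by simp
        then obtain s where s: "s \<in> T" "t < s" "s \<le> d" "G t + \<bar>k t\<bar> / 2 * (s - t) \<le> G s"
          using delta_local_increase[OF T(1) t(1) T(3) t(3) G[OF t]] by blast
        moreover have "0 < \<bar>k t\<bar> / 2 * (s - t)" using \<open>k t \<noteq> 0\<close> s(2) by simp
        ultimately have "G t < G s" by linarith
        then show False
          using False mono[OF T(2) t(1)] mono[OF s(1) T(3)] t s by fastforce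
      qed
      then have "\<bar>F d - F c\<bar> \<le> (\<lambda>_. 0) d - (\<lambda>_. 0) c"
        using has_delta_derivative_cmult[OF _ has_delta_derivative_ident, of _ T 0]
        by (intro delta_mean_value_abs[OF T cont(1) _ F, of _ "\<lambda>_. 0"]) auto
      moreover have "G d = G c" using False \<open>G c \<le> G d\<close> by simp
      ultimately show ?thesis by (cases M) simp_all
    qed
  next
    case MInf
    then show ?thesis using \<open>0 \<le> M\<close> by simp
  qed
qed

text \<open>At a right-dense left end point the derivative is a limit of difference quotients taken over
  the interior, so it inherits a bound that is only assumed there.\<close>

lemma delta_derivative_right_dense_le:
  assumes T: "closed T" "a \<in> T" "b \<in> T" "a < b" and dense: "forward_jump T a = a"
    and f: "continuous_on T f" and D: "has_delta_derivative T f D a"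
    and le: "\<And>t. t \<in> T \<Longrightarrow> a < t \<Longrightarrow> t < b \<Longrightarrow> \<exists>E\<le>M. has_delta_derivative T f E t"
  shows "D \<le> M"
proof (rule ccontr)
  assume "\<not> D \<le> M"
  \<comment> \<open>The midpoint is a slope small enough to be reached from \<open>a\<close>, yet
    larger than the interior bound \<open>M\<close> allows.\<close>
  then have "(D + M) / 2 < D" by simp
  then obtain s where s: "s \<in> T" "a < s" "s \<le> b" "f a + (D + M) / 2 * (s - a) \<le> f s"
    using delta_local_increase[OF T D] by blast
  \<comment> \<open>The mean value inequality for \<open>- f\<close> starts at points
    \<open>t > a\<close>, where the bound is known; afterwards \<open>t\<close> tends to
    \<open>a\<close>.\<close>
  have bound: "f s \<le> f t + M * (s - t)" if t: "t \<in> T" "a < t" "t < s" for t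
  proof -
    have "(\<lambda>x. - 1 * f x) t + (- M) * (s - t) \<le> (\<lambda>x. - 1 * f x) s"
    proof (rule delta_mean_value_ge[OF T(1) t(1) s(1)])
      fix x assume x: "x \<in> T" "t \<le> x" "x < s"
      then obtain E where "E \<le> M" "has_delta_derivative T f E x" using le[of x] t s by auto
      then show "\<exists>D\<ge>- M. has_delta_derivative T (\<lambda>x. - 1 * f x) D x"
        using has_delta_derivative_cmult[OF x(1), of f E "- 1"] by (intro exI[of _ "- 1 * E"]) simp
    qed (use t f in \<open>auto intro!: continuous_on_minus\<close>)
    then show ?thesis by simp
  qed
  have "f s \<le> f a + M * (s - a)"
  proof (rule tendsto_lowerbound)
    have "(f \<longlongrightarrow> f a) (at a within T \<inter> {a<..<s})"
      using f T(2) by (meson Int_lower1 continuous_on_def tendsto_within_subset)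
    then show "((\<lambda>t. f t + M * (s - t)) \<longlongrightarrow> f a + M * (s - a)) (at a within T \<inter> {a<..<s})"
      by (intro tendsto_intros)
    show "\<forall>\<^sub>F t in at a within T \<inter> {a<..<s}. f s \<le> f t + M * (s - t)"
      unfolding eventually_at_filter using bound by (intro always_eventually) auto
    have "a islimpt (T \<inter> {a<..<s})"
      unfolding islimpt_approachable
    proof safe
      fix e :: real assume "e > 0"
      then obtain x where "x \<in> T" "a < x" "x < a + min e (s - a)"
        using right_dense_approx[OF dense s(1,2), of "min e (s - a)"] s(2) by auto
      then show "\<exists>x\<in>T \<inter> {a<..<s}. x \<noteq> a \<and> dist x a < e"
        by (intro bexI[of _ x]) (auto simp: dist_real_def)
    qed
    then show "at a within T \<inter> {a<..<s} \<noteq> bot" by (simp add: trivial_limit_within)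
  qed
  then have "(D + M) / 2 * (s - a) \<le> M * (s - a)" using s(4) by linarith
  then show False using s(2) \<open>\<not> D \<le> M\<close> by simp
qed

subsection \<open>The three-point inequality\<close>

lemma has_delta_derivative_by_parts:
  assumes "t \<in> T" "has_delta_derivative T f D t" "has_delta_derivative T F (f (forward_jump T t)) t"
  shows "has_delta_derivative T (\<lambda>x. (x - \<alpha>) * f x - F x) ((t - \<alpha>) * D) t"
  using has_delta_derivative_diff[OF assms(1) has_delta_derivative_mult_ident[OF assms(1,2), of \<alpha>] assms(3)]
  by simp

lemma has_delta_derivative_diff_linear:
  assumes "t \<in> T" "has_delta_derivative T P D t"
  shows "has_delta_derivative T (\<lambda>x. P x - \<alpha> * x) (D - \<alpha>) t"
  using has_delta_derivative_diff[OF assms has_delta_derivative_cmult[OF assms(1)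
      has_delta_derivative_ident[OF assms(1)], of \<alpha>]] by simp

lemma delta_by_parts_bound:
  fixes M :: ereal
  assumes T: "closed T" "c \<in> T" "\<alpha> \<in> T" "d \<in> T" "c \<le> d"
    and cont: "continuous_on T f" "continuous_on T F" "continuous_on T P" and "0 \<le> M"
    and \<alpha>: "\<alpha> \<le> c \<or> d \<le> \<alpha>"
    and f: "\<And>t. t \<in> T \<Longrightarrow> c \<le> t \<Longrightarrow> t < d \<Longrightarrow> has_delta_derivative T f (f' t) t"
    and F: "\<And>t. t \<in> T \<Longrightarrow> c \<le> t \<Longrightarrow> t < d \<Longrightarrow> has_delta_derivative T F (f (forward_jump T t)) t"
    and P: "\<And>t. t \<in> T \<Longrightarrow> c \<le> t \<Longrightarrow> t < d \<Longrightarrow> has_delta_derivative T P t t"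
    and M: "\<And>t. t \<in> T \<Longrightarrow> c \<le> t \<Longrightarrow> t < d \<Longrightarrow> t \<noteq> \<alpha> \<Longrightarrow> ereal \<bar>f' t\<bar> \<le> M"
  shows "ereal \<bar>((d - \<alpha>) * f d - F d) - ((c - \<alpha>) * f c - F c)\<bar> \<le> M * ereal \<bar>P d - P c - \<alpha> * (d - c)\<bar>"
    and "\<alpha> \<le> c \<Longrightarrow> 0 \<le> P d - P c - \<alpha> * (d - c)"
    and "d \<le> \<alpha> \<Longrightarrow> P d - P c - \<alpha> * (d - c) \<le> 0"
proof -
  \<comment> \<open>The kernel \<open>t - \<alpha>\<close> does not change sign on
    \<open>[c, d)\<close>, so \<open>s * (P x - \<alpha> * x)\<close> is an antiderivative of its
    absolute value.\<close>
  define s :: real where "s = (if \<alpha> \<le> c then 1 else - 1)"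
  have G: "has_delta_derivative T (\<lambda>x. s * (P x - \<alpha> * x)) \<bar>t - \<alpha>\<bar> t"
    if t: "t \<in> T" "c \<le> t" "t < d" for t
  proof -
    have "\<bar>t - \<alpha>\<bar> = s * (t - \<alpha>)" using \<alpha> t by (auto simp: s_def)
    then show ?thesis
      using has_delta_derivative_cmult[OF t(1) has_delta_derivative_diff_linear[OF t(1) P[OF t]]] by simp
  qed
  have \<Phi>: "has_delta_derivative T (\<lambda>x. (x - \<alpha>) * f x - F x) ((t - \<alpha>) * f' t) t"
    if t: "t \<in> T" "c \<le> t" "t < d" for t
    by (rule has_delta_derivative_by_parts[OF t(1) f[OF t] F[OF t]])
  have cont': "continuous_on T (\<lambda>x. (x - \<alpha>) * f x - F x)" "continuous_on T (\<lambda>x. s * (P x - \<alpha> * x))"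
    by (intro continuous_intros cont)+
  note * = delta_weighted_mean_value[OF T(1,2,4,5) cont' \<open>0 \<le> M\<close> \<Phi> G, simplified]
  have le: "s * (P c - \<alpha> * c) \<le> s * (P d - \<alpha> * d)"
    and bound: "ereal \<bar>((d - \<alpha>) * f d - F d) - ((c - \<alpha>) * f c - F c)\<bar>
      \<le> M * ereal (s * (P d - \<alpha> * d) - s * (P c - \<alpha> * c))"
    using M by (auto intro!: *)
  have eq: "s * (P d - \<alpha> * d) - s * (P c - \<alpha> * c) = s * (P d - P c - \<alpha> * (d - c))"
    by (simp add: algebra_simps)
  have "0 \<le> s * (P d - P c - \<alpha> * (d - c))" using le eq by simp
  then have "s * (P d - P c - \<alpha> * (d - c)) = \<bar>P d - P c - \<alpha> * (d - c)\<bar>"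
    by (auto simp: s_def split: if_splits)
  then show "ereal \<bar>((d - \<alpha>) * f d - F d) - ((c - \<alpha>) * f c - F c)\<bar> \<le> M * ereal \<bar>P d - P c - \<alpha> * (d - c)\<bar>"
    using bound eq by simp
  show "0 \<le> P d - P c - \<alpha> * (d - c)" if "\<alpha> \<le> c"
    using le eq that by (simp add: s_def)
  show "P d - P c - \<alpha> * (d - c) \<le> 0" if "d \<le> \<alpha>"
  proof (cases "\<alpha> \<le> c")
    \<comment> \<open>Here \<open>s = 1\<close> would give the opposite sign, but the two conditions
      on \<alpha> force \<open>d = c\<close>.\<close>
    case True
    then have "d = c" using that T by simp
    then show ?thesis by simp
  qed (use le eq in \<open>simp add: s_def\<close>)
qed

text \<open>A bound at \<open>t = a\<close> is asked only for
  \<open>\<alpha>\<^sub>1 \<noteq> a\<close>, since otherwise the kernel vanishes there.\<close>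

lemma three_point_bound:
  fixes M :: ereal
  assumes J: "closed J" and pts: "a \<in> J" "\<alpha>\<^sub>1 \<in> J" "m \<in> J" "\<alpha>\<^sub>2 \<in> J" "b \<in> J"
    and ord: "a \<le> \<alpha>\<^sub>1" "\<alpha>\<^sub>1 \<le> m" "m \<le> \<alpha>\<^sub>2" "\<alpha>\<^sub>2 \<le> b" "a < m"
    and f: "continuous_on J f" "\<And>t. t \<in> J \<Longrightarrow> t < b \<Longrightarrow> has_delta_derivative J f (f' t) t"
    and F: "delta_antiderivative J (\<lambda>t. f (forward_jump J t)) F"
    and P: "continuous_on J P" "\<And>t. t \<in> J \<Longrightarrow> a \<le> t \<Longrightarrow> t < b \<Longrightarrow> has_delta_derivative J P t t"
    and M: "0 \<le> M"
      "\<And>t. t \<in> J \<Longrightarrow> a \<le> t \<Longrightarrow> t < b \<Longrightarrow> a < t \<or> \<alpha>\<^sub>1 \<noteq> a \<Longrightarrow> ereal \<bar>f' t\<bar> \<le> M"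
  shows "ereal \<bar>(F b - F a) - ((\<alpha>\<^sub>1 - a) * f a + (\<alpha>\<^sub>2 - \<alpha>\<^sub>1) * f m + (b - \<alpha>\<^sub>2) * f b)\<bar>
      \<le> M * ereal (h2 P a \<alpha>\<^sub>1 + h2 P m \<alpha>\<^sub>1 + h2 P m \<alpha>\<^sub>2 + h2 P b \<alpha>\<^sub>2)"
proof -
  define \<Phi> where "\<Phi> \<alpha> x = (x - \<alpha>) * f x - F x" for \<alpha> x
  have F': "has_delta_derivative J F (f (forward_jump J t)) t" if "t \<in> J" "t < b" for t
    using F time_scale_kappa_less[OF that(1) pts(5) that(2)] unfolding delta_antiderivative_def by blast
  note contF = delta_antiderivative_imp_continuous_on[OF F]
  \<comment> \<open>The last condition serves the end point \<open>a\<close>: a piece starting there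
    has \<open>\<alpha> = \<alpha>\<^sub>1\<close>, so \<open>t = a\<close> and
    \<open>t \<noteq> \<alpha>\<close> give \<open>\<alpha>\<^sub>1 \<noteq> a\<close>.\<close>
  have piece: "ereal \<bar>\<Phi> \<alpha> d - \<Phi> \<alpha> c\<bar> \<le> M * ereal \<bar>P d - P c - \<alpha> * (d - c)\<bar>"
      "\<alpha> \<le> c \<Longrightarrow> 0 \<le> P d - P c - \<alpha> * (d - c)" "d \<le> \<alpha> \<Longrightarrow> P d - P c - \<alpha> * (d - c) \<le> 0"
    if "c \<in> J" "\<alpha> \<in> J" "d \<in> J" "a \<le> c" "c \<le> d" "d \<le> b" "\<alpha> \<le> c \<or> d \<le> \<alpha>" "\<alpha> = \<alpha>\<^sub>1 \<or> m \<le> c" for c d \<alpha>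
  proof -
    have M': "ereal \<bar>f' t\<bar> \<le> M" if "t \<in> J" "c \<le> t" "t < d" "t \<noteq> \<alpha>" for t
      using that \<open>a \<le> c\<close> \<open>d \<le> b\<close> \<open>\<alpha> = \<alpha>\<^sub>1 \<or> m \<le> c\<close> \<open>a < m\<close> by (intro M) auto
    note * = delta_by_parts_bound[OF J that(1-3,5) f(1) contF P(1) M(1) that(7) f(2) F' P(2) M']
    show "ereal \<bar>\<Phi> \<alpha> d - \<Phi> \<alpha> c\<bar> \<le> M * ereal \<bar>P d - P c - \<alpha> * (d - c)\<bar>"
      unfolding \<Phi>_def by (rule *(1)) (use that in auto)
    show "0 \<le> P d - P c - \<alpha> * (d - c)" if "\<alpha> \<le> c"
      by (rule *(2)) (use that \<open>a \<le> c\<close> \<open>d \<le> b\<close> in auto)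
    show "P d - P c - \<alpha> * (d - c) \<le> 0" if "d \<le> \<alpha>"
      by (rule *(3)) (use that \<open>a \<le> c\<close> \<open>d \<le> b\<close> in auto)
  qed
  have flip: "P \<alpha> - P c - \<alpha> * (\<alpha> - c) = - h2 P c \<alpha>" for c \<alpha>
    by (simp add: h2_def algebra_simps)
  have 1: "ereal \<bar>\<Phi> \<alpha>\<^sub>1 \<alpha>\<^sub>1 - \<Phi> \<alpha>\<^sub>1 a\<bar> \<le> M * ereal (h2 P a \<alpha>\<^sub>1)" "0 \<le> h2 P a \<alpha>\<^sub>1"
    using piece[of a \<alpha>\<^sub>1 \<alpha>\<^sub>1] pts ord unfolding flip by simp_all
  have 2: "ereal \<bar>\<Phi> \<alpha>\<^sub>1 m - \<Phi> \<alpha>\<^sub>1 \<alpha>\<^sub>1\<bar> \<le> M * ereal (h2 P m \<alpha>\<^sub>1)" "0 \<le> h2 P m \<alpha>\<^sub>1"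
    using piece[of \<alpha>\<^sub>1 \<alpha>\<^sub>1 m] pts ord by (simp_all flip: h2_def)
  have 3: "ereal \<bar>\<Phi> \<alpha>\<^sub>2 \<alpha>\<^sub>2 - \<Phi> \<alpha>\<^sub>2 m\<bar> \<le> M * ereal (h2 P m \<alpha>\<^sub>2)" "0 \<le> h2 P m \<alpha>\<^sub>2"
    using piece[of m \<alpha>\<^sub>2 \<alpha>\<^sub>2] pts ord unfolding flip by simp_all
  have 4: "ereal \<bar>\<Phi> \<alpha>\<^sub>2 b - \<Phi> \<alpha>\<^sub>2 \<alpha>\<^sub>2\<bar> \<le> M * ereal (h2 P b \<alpha>\<^sub>2)" "0 \<le> h2 P b \<alpha>\<^sub>2"
    using piece[of \<alpha>\<^sub>2 \<alpha>\<^sub>2 b] pts ord by (simp_all flip: h2_def)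
  have "(F b - F a) - ((\<alpha>\<^sub>1 - a) * f a + (\<alpha>\<^sub>2 - \<alpha>\<^sub>1) * f m + (b - \<alpha>\<^sub>2) * f b)
      = - ((\<Phi> \<alpha>\<^sub>1 \<alpha>\<^sub>1 - \<Phi> \<alpha>\<^sub>1 a) + (\<Phi> \<alpha>\<^sub>1 m - \<Phi> \<alpha>\<^sub>1 \<alpha>\<^sub>1) + (\<Phi> \<alpha>\<^sub>2 \<alpha>\<^sub>2 - \<Phi> \<alpha>\<^sub>2 m) + (\<Phi> \<alpha>\<^sub>2 b - \<Phi> \<alpha>\<^sub>2 \<alpha>\<^sub>2))"
    by (simp add: \<Phi>_def algebra_simps)
  then have "ereal \<bar>(F b - F a) - ((\<alpha>\<^sub>1 - a) * f a + (\<alpha>\<^sub>2 - \<alpha>\<^sub>1) * f m + (b - \<alpha>\<^sub>2) * f b)\<bar>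
      \<le> ereal \<bar>\<Phi> \<alpha>\<^sub>1 \<alpha>\<^sub>1 - \<Phi> \<alpha>\<^sub>1 a\<bar> + ereal \<bar>\<Phi> \<alpha>\<^sub>1 m - \<Phi> \<alpha>\<^sub>1 \<alpha>\<^sub>1\<bar>
        + ereal \<bar>\<Phi> \<alpha>\<^sub>2 \<alpha>\<^sub>2 - \<Phi> \<alpha>\<^sub>2 m\<bar> + ereal \<bar>\<Phi> \<alpha>\<^sub>2 b - \<Phi> \<alpha>\<^sub>2 \<alpha>\<^sub>2\<bar>"
    by simp
  also have "\<dots> \<le> M * ereal (h2 P a \<alpha>\<^sub>1) + M * ereal (h2 P m \<alpha>\<^sub>1)
      + M * ereal (h2 P m \<alpha>\<^sub>2) + M * ereal (h2 P b \<alpha>\<^sub>2)"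
    by (intro add_mono 1 2 3 4)
  \<comment> \<open>As \<open>M\<close> may be infinite, distributivity rests on the nonnegativity
    of the four values.\<close>
  also have "\<dots> = M * ereal (h2 P a \<alpha>\<^sub>1 + h2 P m \<alpha>\<^sub>1 + h2 P m \<alpha>\<^sub>2 + h2 P b \<alpha>\<^sub>2)"
    using 1(2) 2(2) 3(2) 4(2) by (simp only: ereal_right_distrib ereal_less_eq(5) add_nonneg_nonneg
        plus_ereal.simps(1)[symmetric])
  finally show ?thesis .
qed

subsection \<open>Sharpness\<close>

text \<open>\<open>x / (\<bar>x\<bar> + \<epsilon>)\<close> is a continuous sign that loses at most
  \<epsilon> when multiplied by \<open>x\<close>. Between \<open>c\<close> and \<open>m\<close>, to
  the right of \<open>\<alpha>\<^sub>1\<close>, nothing is claimed: there \<open>p\<close> has to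
  change over to the other kernel.\<close>

lemma continuous_sign_approx:
  fixes \<alpha>\<^sub>1 \<alpha>\<^sub>2 m c \<epsilon> :: real
  assumes "\<alpha>\<^sub>1 \<le> m" "m \<le> \<alpha>\<^sub>2" "c < m" "\<epsilon> > 0"
  obtains p where "continuous_on UNIV p" "\<And>t. \<bar>p t\<bar> \<le> 1"
    "\<And>t. t < m \<Longrightarrow> t < \<alpha>\<^sub>1 \<or> t \<le> c \<Longrightarrow> \<bar>t - \<alpha>\<^sub>1\<bar> - \<epsilon> \<le> (t - \<alpha>\<^sub>1) * p t"
    "\<And>t. m \<le> t \<Longrightarrow> \<bar>t - \<alpha>\<^sub>2\<bar> - \<epsilon> \<le> (t - \<alpha>\<^sub>2) * p t"
proof -
  \<comment> \<open>The connecting line in \<open>K\<close> has value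
    \<open>m - \<alpha>\<^sub>2\<close> at \<open>m\<close> and \<open>m - \<alpha>\<^sub>1\<close>
    at \<open>c\<close>, so for \<open>t \<le> c\<close> the minimum is
    \<open>t - \<alpha>\<^sub>1\<close>.\<close>
  define N where "N = (\<alpha>\<^sub>2 - \<alpha>\<^sub>1) / (m - c)"
  have N: "0 \<le> N" "N * (m - c) = \<alpha>\<^sub>2 - \<alpha>\<^sub>1" using assms by (simp_all add: N_def)
  \<comment> \<open>A continuous kernel that agrees with \<open>t - \<alpha>\<^sub>1\<close> up to \<open>c\<close> and with \<open>t - \<alpha>\<^sub>2\<close> from \<open>m\<close> on.\<close>
  define K where "K t = max (t - \<alpha>\<^sub>2) (min (t - \<alpha>\<^sub>1) (m - \<alpha>\<^sub>2 + N * (m - t)))" for t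
  define p where "p t = K t / (\<bar>K t\<bar> + \<epsilon>)" for t
  have pos: "\<bar>K t\<bar> + \<epsilon> > 0" for t using \<open>\<epsilon> > 0\<close> by simp
  \<comment> \<open>\<open>K t\<close> need not equal the kernel value \<open>x\<close>: when
    \<open>x\<close> is nonpositive, a smaller \<open>K t\<close> has a compatible sign and at least
    the same modulus, which suffices.\<close>
  have good: "\<bar>x\<bar> - \<epsilon> \<le> x * p t" if "K t \<le> x \<and> x \<le> 0 \<or> x = K t" for x t
  proof -
    have "(\<bar>x\<bar> - \<epsilon>) * (\<bar>K t\<bar> + \<epsilon>) \<le> x * K t"
    proof -
      have "x * K t = \<bar>x\<bar> * \<bar>K t\<bar>" using that by (auto simp: abs_if mult_nonpos_nonpos)
      moreover have "\<bar>x\<bar> \<le> \<bar>K t\<bar>" using that by auto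
      then have "\<epsilon> * \<bar>x\<bar> \<le> \<epsilon> * \<bar>K t\<bar>" using \<open>\<epsilon> > 0\<close> by simp
      moreover have "0 \<le> \<epsilon> * \<epsilon>" by simp
      moreover have "(\<bar>x\<bar> - \<epsilon>) * (\<bar>K t\<bar> + \<epsilon>) = \<bar>x\<bar> * \<bar>K t\<bar> + \<epsilon> * \<bar>x\<bar> - \<epsilon> * \<bar>K t\<bar> - \<epsilon> * \<epsilon>"
        by (simp add: algebra_simps)
      ultimately show ?thesis by linarith
    qed
    then show ?thesis using pos[of t] by (simp add: p_def pos_le_divide_eq)
  qed
  show ?thesis
  proof
    show "continuous_on UNIV p"
      unfolding p_def K_def using pos[unfolded K_def] by (intro continuous_intros) (auto simp: less_imp_neq[symmetric])
    show "\<bar>p t\<bar> \<le> 1" for t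
      using \<open>\<epsilon> > 0\<close> by (simp add: p_def abs_div divide_le_eq)
    fix t
    show "\<bar>t - \<alpha>\<^sub>1\<bar> - \<epsilon> \<le> (t - \<alpha>\<^sub>1) * p t" if t: "t < m" "t < \<alpha>\<^sub>1 \<or> t \<le> c"
    proof (rule good)
      show "K t \<le> t - \<alpha>\<^sub>1 \<and> t - \<alpha>\<^sub>1 \<le> 0 \<or> t - \<alpha>\<^sub>1 = K t"
      proof (cases "t \<le> c")
        case True
        then have "N * (m - c) \<le> N * (m - t)" using N(1) by (intro mult_left_mono) auto
        then have "t - \<alpha>\<^sub>1 \<le> m - \<alpha>\<^sub>2 + N * (m - t)" using N(2) t(1) by linarith
        then have "K t = t - \<alpha>\<^sub>1" using assms by (simp add: K_def)
        then show ?thesis by simp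
      next
        case False
        then have "t < \<alpha>\<^sub>1" using t by simp
        moreover have "K t \<le> t - \<alpha>\<^sub>1" using assms by (simp add: K_def)
        ultimately show ?thesis by simp
      qed
    qed
    show "\<bar>t - \<alpha>\<^sub>2\<bar> - \<epsilon> \<le> (t - \<alpha>\<^sub>2) * p t" if t: "m \<le> t"
    proof (rule good)
      have "N * (m - t) \<le> 0" using N(1) t by (simp add: mult_nonneg_nonpos)
      then have "m - \<alpha>\<^sub>2 + N * (m - t) \<le> t - \<alpha>\<^sub>2" using t by simp
      then have "min (t - \<alpha>\<^sub>1) (m - \<alpha>\<^sub>2 + N * (m - t)) \<le> t - \<alpha>\<^sub>2" by (rule min.coboundedI2)
      then have "K t = t - \<alpha>\<^sub>2" unfolding K_def by (rule max.absorb1)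
      then show "K t \<le> t - \<alpha>\<^sub>2 \<and> t - \<alpha>\<^sub>2 \<le> 0 \<or> t - \<alpha>\<^sub>2 = K t"
        by simp
    qed
  qed
qed

text \<open>Either \<open>T\<close> has a point after \<open>max u (m - e)\<close> and before
  \<open>m\<close>, or the last point of \<open>T\<close> up to \<open>max u (m - e)\<close> jumps
  directly to \<open>m\<close>.\<close>

lemma left_neighbour:
  assumes T: "closed T" and "u \<in> T" "m \<in> T" "u < m" "e > 0"
  obtains c where "c \<in> T" "u \<le> c" "c < m" "m - c < e \<or> forward_jump T c = m"
proof (cases "\<exists>c\<in>T. max u (m - e) < c \<and> c < m")
  case True
  then show ?thesis using that by fastforce
next
  case False
  let ?A = "T \<inter> {u..max u (m - e)}"
  define c where "c = Sup ?A"
  have "closed ?A" using T by auto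
  then have c: "c \<in> ?A"
    unfolding c_def using assms by (intro closed_contains_Sup) auto
  have "c < m" using c assms by auto
  have "m \<le> s" if "s \<in> T" "c < s" for s
  proof (rule ccontr)
    assume "\<not> m \<le> s"
    then have "s \<in> ?A" using False that c by force
    then have "s \<le> c" unfolding c_def by (intro cSup_upper) auto
    then show False using that by simp
  qed
  then have "m \<le> forward_jump T c"
    using assms \<open>c < m\<close> unfolding forward_jump_def by (auto intro!: cInf_greatest)
  moreover have "forward_jump T c \<le> m" by (rule forward_jump_le[OF assms(3) \<open>c < m\<close>])
  ultimately show ?thesis using c \<open>c < m\<close> by (intro that[of c]) auto
qed

lemma three_point_sharp:
  assumes J: "closed J" and pts: "a \<in> J" "\<alpha>\<^sub>1 \<in> J" "m \<in> J" "\<alpha>\<^sub>2 \<in> J" "b \<in> J"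
    and ord: "a \<le> \<alpha>\<^sub>1" "\<alpha>\<^sub>1 \<le> m" "m \<le> \<alpha>\<^sub>2" "\<alpha>\<^sub>2 \<le> b" "a < m"
    and P: "continuous_on J P" "\<And>t. t \<in> J \<Longrightarrow> a \<le> t \<Longrightarrow> t < b \<Longrightarrow> has_delta_derivative J P t t"
    and C: "C < h2 P a \<alpha>\<^sub>1 + h2 P m \<alpha>\<^sub>1 + h2 P m \<alpha>\<^sub>2 + h2 P b \<alpha>\<^sub>2"
  obtains f F p where "delta_antiderivative J p f" "\<And>t. \<bar>p t\<bar> \<le> 1"
    "delta_antiderivative J (\<lambda>t. f (forward_jump J t)) F"
    "C < \<bar>(F b - F a) - ((\<alpha>\<^sub>1 - a) * f a + (\<alpha>\<^sub>2 - \<alpha>\<^sub>1) * f m + (b - \<alpha>\<^sub>2) * f b)\<bar>"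
proof -
  define S where "S = h2 P a \<alpha>\<^sub>1 + h2 P m \<alpha>\<^sub>1 + h2 P m \<alpha>\<^sub>2 + h2 P b \<alpha>\<^sub>2"
  \<comment> \<open>The four pieces lose \<open>\<epsilon> * (b - a)\<close> in all, and the stretch
    just left of \<open>m\<close> at most twice that; with a quarter of the margin as unit, the
    inequality stays strict.\<close>
  define \<epsilon> where "\<epsilon> = (S - C) / 4 / (b - a)"
  have ab: "a < b" using ord by simp
  have \<epsilon>: "\<epsilon> > 0" using C ab by (simp add: \<epsilon>_def S_def)
  have "\<epsilon> * (b - a) = (S - C) / 4"
    using ab unfolding \<epsilon>_def by (subst times_divide_eq_left, subst nonzero_mult_div_cancel_right) simp_all
  then have S: "4 * (\<epsilon> * (b - a)) = S - C" by (simp only:) simp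
  obtain c where c: "c \<in> J" "a \<le> c" "c < m" "\<alpha>\<^sub>1 < m \<Longrightarrow> \<alpha>\<^sub>1 \<le> c \<and> (m - c < \<epsilon> \<or> forward_jump J c = m)"
  proof (cases "\<alpha>\<^sub>1 < m")
    case True
    from left_neighbour[OF J pts(2,3) True \<epsilon>] obtain c
      where "c \<in> J" "\<alpha>\<^sub>1 \<le> c" "c < m" "m - c < \<epsilon> \<or> forward_jump J c = m" .
    then show ?thesis using ord by (intro that[of c]) auto
  next
    case False
    with pts ord show ?thesis by (intro that[of a]) auto
  qed
  obtain p where p: "continuous_on UNIV p" "\<And>t. \<bar>p t\<bar> \<le> 1"
    "\<And>t. t < m \<Longrightarrow> t < \<alpha>\<^sub>1 \<or> t \<le> c \<Longrightarrow> \<bar>t - \<alpha>\<^sub>1\<bar> - \<epsilon> \<le> (t - \<alpha>\<^sub>1) * p t"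
    "\<And>t. m \<le> t \<Longrightarrow> \<bar>t - \<alpha>\<^sub>2\<bar> - \<epsilon> \<le> (t - \<alpha>\<^sub>2) * p t"
    using continuous_sign_approx[OF ord(2,3) c(3) \<epsilon>] by blast
  obtain f where f: "delta_antiderivative J p f"
    using delta_antiderivative_exists[OF J continuous_on_subset[OF p(1)], of "\<lambda>t. t"]
      forward_jump_ge[of _ J] by auto
  note contf = delta_antiderivative_imp_continuous_on[OF f]
  obtain F where F: "delta_antiderivative J (\<lambda>t. f (forward_jump J t)) F"
    using delta_antiderivative_exists[OF J contf, of "forward_jump J"] forward_jump_in[OF J] forward_jump_ge
    by blast
  note contF = delta_antiderivative_imp_continuous_on[OF F]
  define \<Phi> where "\<Phi> \<alpha> x = (x - \<alpha>) * f x - F x" for \<alpha> x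
  have \<Phi>': "has_delta_derivative J (\<Phi> \<alpha>) ((t - \<alpha>) * p t) t" if "t \<in> J" "t < b" for t \<alpha>
  proof -
    have "t \<in> time_scale_kappa J" using time_scale_kappa_less[OF that(1) pts(5) that(2)] .
    then show ?thesis
      using f F unfolding \<Phi>_def delta_antiderivative_def
      by (intro has_delta_derivative_by_parts that(1)) blast+
  qed
  \<comment> \<open>\<open>s\<close> will be the sign of the kernel on the piece, and
    \<open>- L\<close> the loss per unit length.\<close>
  have piece: "s * (P v - P u - \<alpha> * (v - u)) + L * (v - u) \<le> \<Phi> \<alpha> v - \<Phi> \<alpha> u"
    if uv: "u \<in> J" "v \<in> J" "u \<le> v" "a \<le> u" "v \<le> b"
      and le: "\<And>t. t \<in> J \<Longrightarrow> u \<le> t \<Longrightarrow> t < v \<Longrightarrow> s * (t - \<alpha>) + L \<le> (t - \<alpha>) * p t" for u v s L \<alpha>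
  proof -
    have "(\<lambda>x. \<Phi> \<alpha> x - s * (P x - \<alpha> * x)) u + L * (v - u) \<le> (\<lambda>x. \<Phi> \<alpha> x - s * (P x - \<alpha> * x)) v"
    proof (rule delta_mean_value_ge[OF J uv(1-3)])
      show "continuous_on J (\<lambda>x. \<Phi> \<alpha> x - s * (P x - \<alpha> * x))"
        unfolding \<Phi>_def by (intro continuous_intros contf contF P(1))
      fix t assume t: "t \<in> J" "u \<le> t" "t < v"
      then have "a \<le> t" "t < b" using uv by auto
      note has_delta_derivative_diff[OF t(1) \<Phi>'[OF t(1) \<open>t < b\<close>, of \<alpha>]
          has_delta_derivative_cmult[OF t(1) has_delta_derivative_diff_linear[OF t(1)
            P(2)[OF t(1) \<open>a \<le> t\<close> \<open>t < b\<close>], of \<alpha>], of s]]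
      then show "\<exists>D\<ge>L. has_delta_derivative J (\<lambda>x. \<Phi> \<alpha> x - s * (P x - \<alpha> * x)) D t"
        using le[OF t] by (intro exI[of _ "(t - \<alpha>) * p t - s * (t - \<alpha>)"]) auto
    qed
    then show ?thesis by (simp add: algebra_simps)
  qed
  have flip: "- 1 * (P \<alpha> - P x - \<alpha> * (\<alpha> - x)) = h2 P x \<alpha>" for x \<alpha>
    by (simp add: h2_def algebra_simps)
  have 1: "h2 P a \<alpha>\<^sub>1 - \<epsilon> * (\<alpha>\<^sub>1 - a) \<le> \<Phi> \<alpha>\<^sub>1 \<alpha>\<^sub>1 - \<Phi> \<alpha>\<^sub>1 a"
  proof -
    have "- 1 * (P \<alpha>\<^sub>1 - P a - \<alpha>\<^sub>1 * (\<alpha>\<^sub>1 - a)) + - \<epsilon> * (\<alpha>\<^sub>1 - a) \<le> \<Phi> \<alpha>\<^sub>1 \<alpha>\<^sub>1 - \<Phi> \<alpha>\<^sub>1 a"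
      proof (rule piece)
      fix t assume "t \<in> J" "a \<le> t" "t < \<alpha>\<^sub>1"
      then show "- 1 * (t - \<alpha>\<^sub>1) + - \<epsilon> \<le> (t - \<alpha>\<^sub>1) * p t"
        using p(3)[of t] ord by simp
    qed (use pts ord in auto)
    then show ?thesis unfolding flip by simp
  qed
  have 2: "h2 P m \<alpha>\<^sub>1 - \<epsilon> * (m - \<alpha>\<^sub>1) - 2 * (\<epsilon> * (b - a)) \<le> \<Phi> \<alpha>\<^sub>1 m - \<Phi> \<alpha>\<^sub>1 \<alpha>\<^sub>1"
  proof (cases "\<alpha>\<^sub>1 < m")
    case False
    then show ?thesis using ord \<epsilon> ab by (simp add: h2_def)
  next
    case True
    then have c': "\<alpha>\<^sub>1 \<le> c" "m - c < \<epsilon> \<or> forward_jump J c = m" using c(4) by auto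
    have A: "1 * (P c - P \<alpha>\<^sub>1 - \<alpha>\<^sub>1 * (c - \<alpha>\<^sub>1)) + (- \<epsilon>) * (c - \<alpha>\<^sub>1) \<le> \<Phi> \<alpha>\<^sub>1 c - \<Phi> \<alpha>\<^sub>1 \<alpha>\<^sub>1"
      proof (rule piece)
      fix t assume "t \<in> J" "\<alpha>\<^sub>1 \<le> t" "t < c"
      then show "1 * (t - \<alpha>\<^sub>1) + - \<epsilon> \<le> (t - \<alpha>\<^sub>1) * p t"
        using p(3)[of t] ord c c' by simp
    qed (use pts ord c c' in auto)
    have "1 * (P m - P c - \<alpha>\<^sub>1 * (m - c)) - \<epsilon> * (m - c) - 2 * (\<epsilon> * (b - a)) \<le> \<Phi> \<alpha>\<^sub>1 m - \<Phi> \<alpha>\<^sub>1 c"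
    proof (cases "forward_jump J c = m")
      case True
      have "1 * (P m - P c - \<alpha>\<^sub>1 * (m - c)) + (- \<epsilon>) * (m - c) \<le> \<Phi> \<alpha>\<^sub>1 m - \<Phi> \<alpha>\<^sub>1 c"
      proof (rule piece[OF c(1) pts(3)])
        fix t assume t: "t \<in> J" "c \<le> t" "t < m"
        \<comment> \<open>\<open>c\<close> is the only point of \<open>J\<close> in
          \<open>[c, m)\<close>, and the approximation is still good at \<open>c\<close>.\<close>
        then have "t = c" using forward_jump_le[OF t(1), of c] True by fastforce
        then show "1 * (t - \<alpha>\<^sub>1) + - \<epsilon> \<le> (t - \<alpha>\<^sub>1) * p t"
          using p(3)[of t] t c' by simp
      qed (use c ord in auto)
      moreover have "0 \<le> \<epsilon> * (b - a)" using \<epsilon> ab by simp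
      ultimately show ?thesis by simp
    next
      case False
      \<comment> \<open>Only \<open>\<bar>p t\<bar> \<le> 1\<close> is used here: the loss per unit
        length is at most \<open>2 * (b - a)\<close>, on an interval shorter than
        \<epsilon>.\<close>
      have "1 * (P m - P c - \<alpha>\<^sub>1 * (m - c)) + (- 2 * (b - a)) * (m - c) \<le> \<Phi> \<alpha>\<^sub>1 m - \<Phi> \<alpha>\<^sub>1 c"
      proof (rule piece[OF c(1) pts(3)])
        fix t assume t: "t \<in> J" "c \<le> t" "t < m"
        then have "(t - \<alpha>\<^sub>1) * (- 1) \<le> (t - \<alpha>\<^sub>1) * p t"
          using c' p(2)[of t] by (intro mult_left_mono) auto
        then show "1 * (t - \<alpha>\<^sub>1) + - 2 * (b - a) \<le> (t - \<alpha>\<^sub>1) * p t"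
          using t ord by simp
      qed (use c ord in auto)
      moreover have "- 2 * (b - a) * (m - c) = - 2 * ((b - a) * (m - c))" by (rule mult.assoc)
      moreover have "(b - a) * (m - c) \<le> \<epsilon> * (b - a)"
        unfolding mult.commute[of \<epsilon>] using c' False ab by (intro mult_left_mono) auto
      moreover have "0 \<le> \<epsilon> * (m - c)" using \<epsilon> c by simp
      ultimately show ?thesis by linarith
    qed
    with A show ?thesis by (simp add: h2_def algebra_simps)
  qed
  have 3: "h2 P m \<alpha>\<^sub>2 - \<epsilon> * (\<alpha>\<^sub>2 - m) \<le> \<Phi> \<alpha>\<^sub>2 \<alpha>\<^sub>2 - \<Phi> \<alpha>\<^sub>2 m"
  proof -
    have "- 1 * (P \<alpha>\<^sub>2 - P m - \<alpha>\<^sub>2 * (\<alpha>\<^sub>2 - m)) + - \<epsilon> * (\<alpha>\<^sub>2 - m) \<le> \<Phi> \<alpha>\<^sub>2 \<alpha>\<^sub>2 - \<Phi> \<alpha>\<^sub>2 m"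
      proof (rule piece)
      fix t assume "t \<in> J" "m \<le> t" "t < \<alpha>\<^sub>2"
      then show "- 1 * (t - \<alpha>\<^sub>2) + - \<epsilon> \<le> (t - \<alpha>\<^sub>2) * p t"
        using p(4)[of t] ord by simp
    qed (use pts ord in auto)
    then show ?thesis unfolding flip by simp
  qed
  have 4: "h2 P b \<alpha>\<^sub>2 - \<epsilon> * (b - \<alpha>\<^sub>2) \<le> \<Phi> \<alpha>\<^sub>2 b - \<Phi> \<alpha>\<^sub>2 \<alpha>\<^sub>2"
  proof -
    have "1 * (P b - P \<alpha>\<^sub>2 - \<alpha>\<^sub>2 * (b - \<alpha>\<^sub>2)) + - \<epsilon> * (b - \<alpha>\<^sub>2) \<le> \<Phi> \<alpha>\<^sub>2 b - \<Phi> \<alpha>\<^sub>2 \<alpha>\<^sub>2"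
      proof (rule piece)
      fix t assume "t \<in> J" "\<alpha>\<^sub>2 \<le> t" "t < b"
      then show "1 * (t - \<alpha>\<^sub>2) + - \<epsilon> \<le> (t - \<alpha>\<^sub>2) * p t"
        using p(4)[of t] ord by simp
    qed (use pts ord in auto)
    then show ?thesis by (simp add: h2_def)
  qed
  have "(F b - F a) - ((\<alpha>\<^sub>1 - a) * f a + (\<alpha>\<^sub>2 - \<alpha>\<^sub>1) * f m + (b - \<alpha>\<^sub>2) * f b)
      = - ((\<Phi> \<alpha>\<^sub>1 \<alpha>\<^sub>1 - \<Phi> \<alpha>\<^sub>1 a) + (\<Phi> \<alpha>\<^sub>1 m - \<Phi> \<alpha>\<^sub>1 \<alpha>\<^sub>1) + (\<Phi> \<alpha>\<^sub>2 \<alpha>\<^sub>2 - \<Phi> \<alpha>\<^sub>2 m) + (\<Phi> \<alpha>\<^sub>2 b - \<Phi> \<alpha>\<^sub>2 \<alpha>\<^sub>2))"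
    by (simp add: \<Phi>_def algebra_simps)
  moreover have "\<epsilon> * (\<alpha>\<^sub>1 - a) + \<epsilon> * (m - \<alpha>\<^sub>1) + \<epsilon> * (\<alpha>\<^sub>2 - m) + \<epsilon> * (b - \<alpha>\<^sub>2) = \<epsilon> * (b - a)"
    by (simp add: algebra_simps)
  moreover have "0 < \<epsilon> * (b - a)" using \<epsilon> ab by simp
  ultimately have "C < \<bar>(F b - F a) - ((\<alpha>\<^sub>1 - a) * f a + (\<alpha>\<^sub>2 - \<alpha>\<^sub>1) * f m + (b - \<alpha>\<^sub>2) * f b)\<bar>"
    using 1 2 3 4 S unfolding S_def by linarith
  then show ?thesis using that f p(2) F by blast
qed

text \<open>The open range misses the derivative at \<open>a\<close>. If \<open>a\<close> is
  right-dense, the interior controls it; if \<open>\<alpha>\<^sub>1 = a\<close>, it has weight 0.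
  The range \<open>{a..<b}\<close> contains \<open>a\<close>, so no such case distinction
  arises.\<close>

theorem corollary5:
  fixes T :: "real set" and a b \<alpha>\<^sub>1 \<alpha>\<^sub>2 :: real
  assumes "time_scale T"
    and "a \<in> T" and "b \<in> T" and "a < b" and "(a + b) / 2 \<in> T"
    and "\<alpha>\<^sub>1 \<in> {a..(a + b) / 2} \<inter> T"
    and "\<alpha>\<^sub>2 \<in> {(a + b) / 2..b} \<inter> T"
  shows "let J = {a..b} \<inter> T;
             E = (\<lambda>f. \<bar>delta_integral J (\<lambda>t. f (forward_jump J t)) a b
                       - ((\<alpha>\<^sub>1 - a) * f a + (\<alpha>\<^sub>2 - \<alpha>\<^sub>1) * f ((a + b) / 2) + (b - \<alpha>\<^sub>2) * f b)\<bar>);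
             S = delta_h T 2 a \<alpha>\<^sub>1 + delta_h T 2 ((a + b) / 2) \<alpha>\<^sub>1
                 + delta_h T 2 ((a + b) / 2) \<alpha>\<^sub>2 + delta_h T 2 b \<alpha>\<^sub>2
         in (forward_jump T a = a \<or> \<alpha>\<^sub>1 = a \<longrightarrow>
               sharp_inequality (delta_differentiable J) E (\<lambda>f. delta_deriv_sup J f {a<..<b}) S)
            \<and> sharp_inequality (delta_differentiable J) E (\<lambda>f. delta_deriv_sup J f {a..<b}) S"
proof -
  define m where "m = (a + b) / 2"
  define J where "J = {a..b} \<inter> T"
  define E where "E f = \<bar>delta_integral J (\<lambda>t. f (forward_jump J t)) a b
      - ((\<alpha>\<^sub>1 - a) * f a + (\<alpha>\<^sub>2 - \<alpha>\<^sub>1) * f m + (b - \<alpha>\<^sub>2) * f b)\<bar>" for f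
  define S where "S = delta_h T 2 a \<alpha>\<^sub>1 + delta_h T 2 m \<alpha>\<^sub>1 + delta_h T 2 m \<alpha>\<^sub>2 + delta_h T 2 b \<alpha>\<^sub>2"
  have T: "closed T" using assms(1) by (simp add: time_scale_def)
  then have J: "closed J" by (auto simp: J_def)
  have ord: "a \<le> \<alpha>\<^sub>1" "\<alpha>\<^sub>1 \<le> m" "m \<le> \<alpha>\<^sub>2" "\<alpha>\<^sub>2 \<le> b" "a < m" and "m < b"
    using assms by (auto simp: m_def)
  then have pts: "a \<in> J" "\<alpha>\<^sub>1 \<in> J" "m \<in> J" "\<alpha>\<^sub>2 \<in> J" "b \<in> J"
    using assms by (auto simp: J_def m_def)
  have \<kappa>: "t \<in> time_scale_kappa J" if "t \<in> J" "t < b" for t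
    using time_scale_kappa_less[OF that(1) pts(5) that(2)] .
  obtain P where P: "delta_antiderivative T (\<lambda>x. x) P"
    using delta_antiderivative_exists[OF T continuous_on_id, of "\<lambda>x. x"] forward_jump_ge[of _ T] by auto
  have P_cont: "continuous_on J P"
    using delta_antiderivative_imp_continuous_on[OF P] by (rule continuous_on_subset) (simp add: J_def)
  have P': "has_delta_derivative J P t t" if "t \<in> J" "a \<le> t" "t < b" for t
  proof -
    have "t \<in> time_scale_kappa T"
      using that assms(3) by (intro time_scale_kappa_less[of t T b]) (auto simp: J_def)
    then show ?thesis
      unfolding J_def using P that assms(3) unfolding delta_antiderivative_def
      by (intro has_delta_derivative_interval) auto
  qed
  have S_eq: "S = h2 P a \<alpha>\<^sub>1 + h2 P m \<alpha>\<^sub>1 + h2 P m \<alpha>\<^sub>2 + h2 P b \<alpha>\<^sub>2"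
    unfolding S_def using pts by (simp add: J_def delta_h_2[OF T _ _ P])
  have E_eq: "E f = \<bar>F b - F a - ((\<alpha>\<^sub>1 - a) * f a + (\<alpha>\<^sub>2 - \<alpha>\<^sub>1) * f m + (b - \<alpha>\<^sub>2) * f b)\<bar>"
    if "delta_antiderivative J (\<lambda>t. f (forward_jump J t)) F" for f F
    unfolding E_def delta_integral_eq[OF J pts(1,5) that] ..
  have deriv: "has_delta_derivative J f (delta_deriv J f t) t"
    if f: "delta_differentiable J f" and t: "t \<in> J" "t < b" for f t
  proof -
    obtain D where D: "has_delta_derivative J f D t"
      using f \<kappa>[OF t] unfolding delta_differentiable_def by blast
    then show ?thesis using delta_deriv_eq[OF J t(1) pts(5) t(2) D] by simp
  qed
  have upper: "ereal (E f) \<le> delta_deriv_sup J f X * ereal S"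
    if f: "delta_differentiable J f" and X: "{a<..<b} \<subseteq> X"
      and bound: "\<And>t. t \<in> J \<Longrightarrow> a \<le> t \<Longrightarrow> t < b \<Longrightarrow> a < t \<or> \<alpha>\<^sub>1 \<noteq> a \<Longrightarrow>
        ereal \<bar>delta_deriv J f t\<bar> \<le> delta_deriv_sup J f X" for f X
  proof -
    note f_cont = delta_differentiable_imp_continuous_on[OF f]
    obtain F where F: "delta_antiderivative J (\<lambda>t. f (forward_jump J t)) F"
      using delta_antiderivative_exists[OF J f_cont, of "forward_jump J"]
        forward_jump_in[OF J] forward_jump_ge by blast
    \<comment> \<open>The supremum is nonnegative because its range contains the interior point
      \<open>m\<close>.\<close>
    have "0 \<le> ereal \<bar>delta_deriv J f m\<bar>" by simp
    also have "\<dots> \<le> delta_deriv_sup J f X"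
      using bound[OF pts(3)] ord \<open>m < b\<close> by simp
    finally show ?thesis
      unfolding E_eq[OF F] S_eq
      by (intro three_point_bound[OF J pts ord f_cont deriv[OF f] F P_cont P' _ bound])
  qed
  have upper_open: "ereal \<bar>delta_deriv J f t\<bar> \<le> delta_deriv_sup J f {a<..<b}"
    if f: "delta_differentiable J f" and a: "forward_jump T a = a \<or> \<alpha>\<^sub>1 = a"
      and t: "t \<in> J" "a \<le> t" "t < b" "a < t \<or> \<alpha>\<^sub>1 \<noteq> a" for f t
  proof (cases "a < t")
    case True
    then show ?thesis
      unfolding delta_deriv_sup_def using t by (intro SUP_upper) auto
  next
    case False
    then have [simp]: "t = a" using t by simp
    have dense: "forward_jump J a = a"
      using a t(4) forward_jump_interval[OF assms(3) order_refl assms(4)] by (simp add: J_def)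
    have le: "\<bar>delta_deriv J f x\<bar> \<le> M"
      if "delta_deriv_sup J f {a<..<b} = ereal M" "x \<in> J" "a < x" "x < b" for x M
    proof -
      have "ereal \<bar>delta_deriv J f x\<bar> \<le> delta_deriv_sup J f {a<..<b}"
        unfolding delta_deriv_sup_def using that by (intro SUP_upper) auto
      then show ?thesis using that(1) by simp
    qed
    show ?thesis
    proof (cases "delta_deriv_sup J f {a<..<b}")
      case (real M)
      note f_cont = delta_differentiable_imp_continuous_on[OF f]
      \<comment> \<open>Here \<open>t = a\<close> and \<open>\<alpha>\<^sub>1 \<noteq> a\<close>, so
        \<open>a\<close> is right-dense; the limit argument for \<open>f\<close> and for
        \<open>- f\<close> bounds the absolute value.\<close>
      have "delta_deriv J f a \<le> M"
      proof (rule delta_derivative_right_dense_le[OF J pts(1,5) assms(4) dense f_cont])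
        show "has_delta_derivative J f (delta_deriv J f a) a" by (rule deriv[OF f pts(1) assms(4)])
        show "\<exists>E\<le>M. has_delta_derivative J f E x" if "x \<in> J" "a < x" "x < b" for x
          using deriv[OF f that(1,3)] le[OF real that] by (intro exI[of _ "delta_deriv J f x"]) simp
      qed
      moreover have "- 1 * delta_deriv J f a \<le> M"
      proof (rule delta_derivative_right_dense_le[OF J pts(1,5) assms(4) dense])
        show "continuous_on J (\<lambda>x. - 1 * f x)" by (intro continuous_on_mult_left f_cont)
        show "has_delta_derivative J (\<lambda>x. - 1 * f x) (- 1 * delta_deriv J f a) a"
          by (rule has_delta_derivative_cmult[OF pts(1) deriv[OF f pts(1) assms(4)]])
        show "\<exists>E\<le>M. has_delta_derivative J (\<lambda>x. - 1 * f x) E x" if "x \<in> J" "a < x" "x < b" for x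
          using has_delta_derivative_cmult[OF that(1) deriv[OF f that(1,3)], of "- 1"] le[OF real that]
          by (intro exI[of _ "- 1 * delta_deriv J f x"]) simp
      qed
      ultimately show ?thesis by (simp add: real abs_le_iff)
    next
      case MInf
      have "ereal \<bar>delta_deriv J f m\<bar> \<le> delta_deriv_sup J f {a<..<b}"
        unfolding delta_deriv_sup_def using pts ord \<open>m < b\<close> by (intro SUP_upper) auto
      then show ?thesis by (simp add: MInf)
    qed simp
  qed
  have lower: "\<exists>f. delta_differentiable J f \<and> delta_deriv_sup J f X < \<infinity> \<and>
      delta_deriv_sup J f X * ereal C < ereal (E f)"
    if X: "{a<..<b} \<subseteq> X" "X \<subseteq> {a..<b}" and C: "C < S" for X C
  proof (cases "C < 0")
    \<comment> \<open>For negative \<open>C\<close> an upper bound on the supremum is not enough, as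
      a smaller one makes the product larger. The identity has supremum exactly 1 and a nonnegative
      error.\<close>
    case True
    have id: "has_delta_derivative J (\<lambda>x. x) 1 t" if "t \<in> J" for t
      by (rule has_delta_derivative_ident[OF that])
    have "delta_deriv_sup J (\<lambda>x. x) X = (SUP x\<in>X \<inter> J. 1)"
      unfolding delta_deriv_sup_def using X delta_deriv_eq[OF J _ pts(5) _ id]
      by (intro SUP_cong) auto
    also have "\<dots> = 1"
      using X pts ord \<open>m < b\<close> by (intro SUP_const) auto
    finally have "delta_deriv_sup J (\<lambda>x. x) X = 1" .
    moreover have "C < E (\<lambda>x. x)" using True by (simp add: E_def)
    moreover have "delta_differentiable J (\<lambda>x. x)"
      using id unfolding delta_differentiable_def time_scale_kappa_def by blast
    ultimately show ?thesis by (intro exI[of _ "\<lambda>x. x"]) simp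
  next
    case False
    obtain f F p where f: "delta_antiderivative J p f" and p: "\<And>t. \<bar>p t\<bar> \<le> 1"
      and F: "delta_antiderivative J (\<lambda>t. f (forward_jump J t)) F"
      and less: "C < \<bar>(F b - F a) - ((\<alpha>\<^sub>1 - a) * f a + (\<alpha>\<^sub>2 - \<alpha>\<^sub>1) * f m + (b - \<alpha>\<^sub>2) * f b)\<bar>"
      by (rule three_point_sharp[OF J pts ord P_cont _ C[unfolded S_eq]]) ((rule P'; assumption), rule that)
    have sup: "delta_deriv_sup J f X \<le> 1"
      unfolding delta_deriv_sup_def
    proof (rule SUP_least)
      fix x assume "x \<in> X \<inter> J"
      then have x: "x \<in> J" "x < b" using X by auto
      then have "delta_deriv J f x = p x"
        using f \<kappa>[OF x] unfolding delta_antiderivative_def by (intro delta_deriv_eq[OF J x(1) pts(5) x(2)]) blast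
      then show "ereal \<bar>delta_deriv J f x\<bar> \<le> 1" using p[of x] by simp
    qed
    then have "delta_deriv_sup J f X * ereal C \<le> 1 * ereal C"
      using False by (intro ereal_mult_right_mono) auto
    also have "\<dots> < ereal (E f)" using less by (simp add: E_eq[OF F])
    finally have "delta_deriv_sup J f X * ereal C < ereal (E f)" .
    moreover have "delta_deriv_sup J f X < \<infinity>" using le_less_trans[OF sup, of "\<infinity>"] by (simp add: one_ereal_def)
    moreover have "delta_differentiable J f"
      using f unfolding delta_antiderivative_def delta_differentiable_def by blast
    ultimately show ?thesis by (intro exI[of _ f] conjI)
  qed
  have "sharp_inequality (delta_differentiable J) E (\<lambda>f. delta_deriv_sup J f {a<..<b}) S"
    if "forward_jump T a = a \<or> \<alpha>\<^sub>1 = a"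
    unfolding sharp_inequality_def
  proof (intro conjI allI impI)
    show "ereal (E f) \<le> delta_deriv_sup J f {a<..<b} * ereal S" if f: "delta_differentiable J f" for f
      by (rule upper[OF f order_refl upper_open[OF f \<open>forward_jump T a = a \<or> \<alpha>\<^sub>1 = a\<close>]])
  qed (rule lower, auto)
  moreover have "sharp_inequality (delta_differentiable J) E (\<lambda>f. delta_deriv_sup J f {a..<b}) S"
    unfolding sharp_inequality_def
  proof (intro conjI allI impI)
    show "ereal (E f) \<le> delta_deriv_sup J f {a..<b} * ereal S" if "delta_differentiable J f" for f
    proof (rule upper[OF that])
      show "ereal \<bar>delta_deriv J f t\<bar> \<le> delta_deriv_sup J f {a..<b}" if "t \<in> J" "a \<le> t" "t < b" for t
        unfolding delta_deriv_sup_def using that by (intro SUP_upper) auto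
    qed auto
  qed (rule lower, auto)
  ultimately show ?thesis
    unfolding Let_def E_def[abs_def] S_def J_def m_def by (intro conjI impI)
qed

end
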